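(* Let $\langle\mathfrak V,\mathfrak W;X,\mathbb R^+\rangle$ be a $(\Theta,\mathcal E)$-structure, $\mathfrak V=\langle\langle\mathfrak E,\tau\rangle,\pi,X,\mathfrak N\rangle$, $\mathfrak W=\langle\langle\mathfrak M,\gamma\rangle,\rho,X,\mathfrak R\rangle$, with $\mathfrak M_x\subseteq\bigcap_{\lambda>0}\mathfrak L_1(\mathbb R^+,\mathcal L_{S_x}(\mathfrak E_x);\mu_\lambda)$ for all $x\in X$. Let $\langle\mathcal H,\mathfrak T\rangle$, $\mathcal A$ be as in a consistent class of data whose family of spaces is $\{\mathfrak E_x\}_{x\in X}$ and whose topologies $\tau_x$ are such that $\langle\mathcal L(\mathfrak E_x),\tau_x\rangle=\mathcal L_{S_x}(\mathfrak E_x)$, let $\mathfrak G$ and $\Psi_{\mathbb R^+}^{\mathcal H}$ be the associated objects (see context), and assume $\Gamma(\pi)\cap\mathcal H\cap\prod_{x\in X}\bigcup_{B\in\Theta}\mathcal B^x_B\neq\emptyset$. Let $$\mathcal O\subseteq\Gamma(\rho),\qquad \mathcal D\subseteq\Gamma(\pi)\cap\mathcal H\cap\prod_{x\in X}\bigcup_{B\in\Theta}\mathcal B^x_B .$$ If there is $\mathcal F\subset\bigcap_{\lambda>0}\mathfrak L_1(\mathbb R^+,\mathfrak G,\mu_\lambda)$ with $\Psi^{\mathcal H}_{\mathbb R^+}(\mathcal F)=\mathcal O$, then $\langle\mathfrak V,\mathfrak W;X,\mathbb R^+\rangle$ has the property $\mathsf{LD}(\mathcal O,\mathcal D)$ if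 and only if for all $\lambda>0$, $\overline F\in\mathcal F$ and $v\in\mathcal D$ $$\Bigl(\int\overline F(s)\,d\mu_\lambda(s)\Bigr)(v)\in\Gamma(\pi).$$ In particular, if such an $\mathcal F$ exists and $g(v)\in\Gamma(\pi)$ for all $g\in\mathfrak G$, $v\in\mathcal D$, then $\mathsf{LD}(\mathcal O,\mathcal D)$ holds.
   Context: Vector spaces are over $\mathbb C$; Hlcs means Hausdorff locally convex space; $\mathcal L(E)$ denotes the continuous, $End(E)$ all linear endomorphisms of $E$. $\mu_\lambda$ is the measure $e^{-\lambda s}ds$ on $\mathbb R^+=[0,\infty[$. For $Y$ locally compact, $\mu$ a Radon measure, $E$ a Hlcs, $\mathfrak L_1(Y,E,\mu)$ is the space of scalarly essentially $\mu$-integrable maps $Y\to E$ whose (weak) integral belongs to $E$ (Bourbaki). Bundles. A bundle of $\Omega$-spaces $\langle\langle\mathfrak E,\tau\rangle,\pi,X,\mathfrak N\rangle$ (Gierz) consists of topological spaces $\langle\mathfrak E,\tau\rangle$ and $X$, a continuous open surjection $\pi:\mathfrak E\to X$, a vector space structure on each stalk $\mathfrak E_x=\pi^{-1}(x)$ such that addition $\{(a,b):\pi(a)=\pi(b)\}\to\mathfrak E$ and scalar multiplication are continuous, and a set $\mathfrak N=\{\nu_j:j\in J\}$ of functions $\mathfrak E\to[0,\infty[$ whose restrictions to each $\mathfrak E_x$ form a directed family of seminorms generating the (Hausdorff) topology induced by $\tau$ on $\mathfrak E_x$. $\Gamma_U(\pi)$ is the set of continuous sections $\sigma$ over $U\subseteq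 X$ with $\sup_{x\in U}\nu_j(\sigma(x))<\infty$ for all $j$; $\Gamma(\pi)=\Gamma_X(\pi)$. The tubes $\{\beta:\pi(\beta)\in U,\nu_j(\beta-\sigma(\pi(\beta)))<\varepsilon\}$ ($U$ open, $\sigma\in\Gamma_U(\pi)$, $\varepsilon>0$, $j\in J$) form a base of $\tau$. $(\Theta,\mathcal E)$-structure. Let $\mathcal E\subseteq\Gamma(\pi)$, $\Theta\subseteq\prod_xBounded(\mathfrak E_x)$, $\mathsf D(B,\mathcal E)=\mathcal E\cap\prod_xB(x)$, $\mathcal B_B^x=\{v(x):v\in\mathsf D(B,\mathcal E)\}$, $S_x=\{\mathcal B_B^x:B\in\Theta\}$; $\mathcal L_{S_x}(\mathfrak E_x)$ is $\mathcal L(\mathfrak E_x)$ with uniform convergence on members of $S_x$. Let $Y$ be a Hausdorff space. $\langle\mathfrak V,\mathfrak W;X,Y\rangle$ is a $(\Theta,\mathcal E)$-structure if $\mathsf D(B,\mathcal E)\ne\emptyset$ for all $B\in\Theta$, $\bigcup_{B}\mathcal B_B^x$ is total in $\mathfrak E_x$ for all $x$, and $\mathfrak W$ is a bundle of $\Omega$-spaces with stalks $\mathfrak M_x$ linear subspaces of $\mathcal C(Y,\mathcal L_{S_x}(\mathfrak E_x))$ and directed family of seminorms $\sup_{(K,j,B)\in O}q^x_{(K,j,B)}$, $O$ finite $\subset Comp(Y)\times J\times\Theta$, $q^x_{(K,j,B)}(f)=\sup_{t\in K}\sup_{v\in\mathsf D(B,\mathcal E)}\nu_j(f(t)v(x))$.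 $\mathsf{LD}(\mathcal O,\mathcal D)$: for all $\lambda>0$, $H\in\mathcal O$, $w\in\mathcal D$, the section $x\mapsto\bigl(\int_0^\infty e^{-\lambda s}H(x)(s)ds\bigr)w(x)$ (integral in $\mathcal L_{S_x}(\mathfrak E_x)$) belongs to $\Gamma(\pi)$. Consistent class of data. $\Pr_x$ denotes projections of products and $\imath_x$ the canonical injections of factors into products (zero in other coordinates). $\langle\mathcal H,\mathfrak T\rangle$ is a Hlcs, $\mathcal H$ a linear subspace of $\prod_x\mathfrak E_x$ with $\imath_x(\mathfrak E_x)\subset\mathcal H$ and with $\Pr_x:\langle\mathcal H,\mathfrak T\rangle\to\mathfrak E_x$, $\imath_x:\mathfrak E_x\to\langle\mathcal H,\mathfrak T\rangle$ continuous for all $x$; $\mathcal A\subseteq\prod_x\mathcal L(\mathfrak E_x)$ is a linear subspace with $\theta(u)|_{\mathcal H}\in\mathcal L(\langle\mathcal H,\mathfrak T\rangle)$ for $u\in\mathcal A$ and $\imath_x(\mathcal L(\mathfrak E_x))\subseteq\mathcal A$ for all $x$, where $\theta:\prod_xEnd(\mathfrak E_x)\to End(\prod_x\mathfrak E_x)$, $\Pr_x\circ\theta(u)=\Pr_x(u)\circ\Pr_x$. $\mathfrak G$ is $\{\theta(u)|_{\mathcal H}:u\in\mathcal A\}$ with the finest locally convex topology making all $h_x:\langle\mathcal L(\mathfrak E_x),\tau_x\rangle\to\mathfrak G$, $h_x(f)=(\imath_x\circ f\circ\Pr_x)|_{\mathcal H}$, continuous. $\Psi_{\mathbb R^+}^{\mathcal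 H}(\overline F)(x)(s)=\Pr_x\circ\overline F(s)\circ\imath_x$ for $\overline F\in End(\mathcal H)^{\mathbb R^+}$. *)

theory Defs
  imports "HOL-Analysis.Analysis" "HOL-Algebra.Algebraic_Closure_Type"
begin

section \<open>Complex vector spaces on carrier sets\<close>

text \<open>
  The stalks of a bundle are vector spaces on different subsets of one type, so vector spaces
  are modules, in the sense of HOL-Algebra, over the ring of complex numbers. Functions on a
  set are extensional (\<^term>\<open>undefined\<close> outside it), so that products and function spaces
  are literally sets of functions. The fields \<^const>\<open>monoid.mult\<close> and \<^const>\<open>one\<close>, inherited
  by the module record from rings, play no role.
\<close>

type_synonym 'v cvs = "(complex, 'v) module"

abbreviation CC :: "complex ring" where
  "CC \<equiv> ring_of_type_algebra"

abbreviation vector_space_on :: "'v cvs \<Rightarrow> bool" where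
  "vector_space_on M \<equiv> Module.module CC M"

abbreviation linear_subspace :: "'v set \<Rightarrow> 'v cvs \<Rightarrow> bool" where
  "linear_subspace W M \<equiv> submodule W CC M"

abbreviation subspace_of :: "'v cvs \<Rightarrow> 'v set \<Rightarrow> 'v cvs" where
  "subspace_of M W \<equiv> M\<lparr>carrier := W\<rparr>"

definition prod_space :: "'i set \<Rightarrow> ('i \<Rightarrow> 'v cvs) \<Rightarrow> ('i \<Rightarrow> 'v) cvs" where
  "prod_space I M = \<lparr>carrier = (\<Pi>\<^sub>E i\<in>I. carrier (M i)), monoid.mult = undefined, one = undefined,
     ring.zero = (\<lambda>i\<in>I. \<zero>\<^bsub>M i\<^esub>), ring.add = (\<lambda>f g. \<lambda>i\<in>I. f i \<oplus>\<^bsub>M i\<^esub> g i),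
     module.smult = (\<lambda>c f. \<lambda>i\<in>I. c \<odot>\<^bsub>M i\<^esub> f i)\<rparr>"

text \<open>The canonical injection of the factor \<open>i\<close> into the product.\<close>

definition inj_factor :: "'i set \<Rightarrow> ('i \<Rightarrow> 'v cvs) \<Rightarrow> 'i \<Rightarrow> 'v \<Rightarrow> 'i \<Rightarrow> 'v" where
  "inj_factor I M i a = (\<lambda>j\<in>I. if j = i then a else \<zero>\<^bsub>M j\<^esub>)"

definition linear_span :: "'v cvs \<Rightarrow> 'v set \<Rightarrow> 'v set" where
  "linear_span M S = \<Inter>{W. linear_subspace W M \<and> S \<subseteq> W}"

definition endomorphisms :: "'v cvs \<Rightarrow> ('v \<Rightarrow> 'v) set" where
  "endomorphisms M = {f \<in> carrier M \<rightarrow>\<^sub>E carrier M.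
     (\<forall>a\<in>carrier M. \<forall>b\<in>carrier M. f (a \<oplus>\<^bsub>M\<^esub> b) = f a \<oplus>\<^bsub>M\<^esub> f b) \<and>
     (\<forall>c. \<forall>a\<in>carrier M. f (c \<odot>\<^bsub>M\<^esub> a) = c \<odot>\<^bsub>M\<^esub> f a)}"

definition convex_in :: "'v cvs \<Rightarrow> 'v set \<Rightarrow> bool" where
  "convex_in M C \<longleftrightarrow> C \<subseteq> carrier M \<and>
     (\<forall>a\<in>C. \<forall>b\<in>C. \<forall>t::real. 0 \<le> t \<and> t \<le> 1 \<longrightarrow>
        complex_of_real (1 - t) \<odot>\<^bsub>M\<^esub> a \<oplus>\<^bsub>M\<^esub> complex_of_real t \<odot>\<^bsub>M\<^esub> b \<in> C)"

definition seminorm_on :: "'v cvs \<Rightarrow> ('v \<Rightarrow> real) \<Rightarrow> bool" where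
  "seminorm_on M p \<longleftrightarrow>
     (\<forall>a\<in>carrier M. 0 \<le> p a) \<and>
     (\<forall>a\<in>carrier M. \<forall>b\<in>carrier M. p (a \<oplus>\<^bsub>M\<^esub> b) \<le> p a + p b) \<and>
     (\<forall>c. \<forall>a\<in>carrier M. p (c \<odot>\<^bsub>M\<^esub> a) = cmod c * p a)"

definition seminorm_topology :: "'v cvs \<Rightarrow> ('v \<Rightarrow> real) set \<Rightarrow> 'v topology" where
  "seminorm_topology M P = topology_generated_by (insert (carrier M)
     {{b \<in> carrier M. p (b \<ominus>\<^bsub>M\<^esub> a) < \<epsilon>} | p a \<epsilon>. p \<in> P \<and> a \<in> carrier M \<and> 0 < \<epsilon>})"


section \<open>Locally convex spaces\<close>

definition topological_vs :: "'v cvs \<Rightarrow> 'v topology \<Rightarrow> bool" where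
  "topological_vs M T \<longleftrightarrow> vector_space_on M \<and> topspace T = carrier M \<and>
     continuous_map (prod_topology T T) T (\<lambda>(a, b). a \<oplus>\<^bsub>M\<^esub> b) \<and>
     continuous_map (prod_topology euclidean T) T (\<lambda>(c, a). c \<odot>\<^bsub>M\<^esub> a)"

definition locally_convex :: "'v cvs \<Rightarrow> 'v topology \<Rightarrow> bool" where
  "locally_convex M T \<longleftrightarrow> topological_vs M T \<and> neighbourhood_base_at \<zero>\<^bsub>M\<^esub> (convex_in M) T"

definition Hlcs :: "'v cvs \<Rightarrow> 'v topology \<Rightarrow> bool" where
  "Hlcs M T \<longleftrightarrow> locally_convex M T \<and> Hausdorff_space T"

definition bounded_sets :: "'v cvs \<Rightarrow> 'v topology \<Rightarrow> 'v set set" where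
  "bounded_sets M T = {S. S \<subseteq> carrier M \<and>
     (\<forall>U. openin T U \<and> \<zero>\<^bsub>M\<^esub> \<in> U \<longrightarrow>
        (\<exists>r>0. S \<subseteq> (\<lambda>a. complex_of_real r \<odot>\<^bsub>M\<^esub> a) ` U))}"

definition total_in :: "'v cvs \<Rightarrow> 'v topology \<Rightarrow> 'v set \<Rightarrow> bool" where
  "total_in M T S \<longleftrightarrow> S \<subseteq> carrier M \<and> T closure_of (linear_span M S) = carrier M"

definition continuous_endos :: "'v cvs \<Rightarrow> 'v topology \<Rightarrow> ('v \<Rightarrow> 'v) set" where
  "continuous_endos M T = {f \<in> endomorphisms M. continuous_map T T f}"

definition endo_space :: "'v cvs \<Rightarrow> 'v topology \<Rightarrow> ('v \<Rightarrow> 'v) cvs" where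
  "endo_space M T = subspace_of (prod_space (carrier M) (\<lambda>_. M)) (continuous_endos M T)"

definition cts_fun_space :: "'y topology \<Rightarrow> 'v cvs \<Rightarrow> 'v topology \<Rightarrow> ('y \<Rightarrow> 'v) cvs" where
  "cts_fun_space Y M T = subspace_of (prod_space (topspace Y) (\<lambda>_. M))
     {f \<in> topspace Y \<rightarrow>\<^sub>E carrier M. continuous_map Y T f}"

definition top_dual :: "'v cvs \<Rightarrow> 'v topology \<Rightarrow> ('v \<Rightarrow> complex) set" where
  "top_dual M T = {\<phi> \<in> extensional (carrier M).
     (\<forall>a\<in>carrier M. \<forall>b\<in>carrier M. \<phi> (a \<oplus>\<^bsub>M\<^esub> b) = \<phi> a + \<phi> b) \<and>
     (\<forall>c. \<forall>a\<in>carrier M. \<phi> (c \<odot>\<^bsub>M\<^esub> a) = c * \<phi> a) \<and>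
     continuous_map T euclidean \<phi>}"

definition is_finest_lc_topology ::
  "'v cvs \<Rightarrow> 'i set \<Rightarrow> ('i \<Rightarrow> 'w topology) \<Rightarrow> ('i \<Rightarrow> 'w \<Rightarrow> 'v) \<Rightarrow> 'v topology \<Rightarrow> bool" where
  "is_finest_lc_topology M I S h T \<longleftrightarrow>
     locally_convex M T \<and> (\<forall>i\<in>I. continuous_map (S i) T (h i)) \<and>
     (\<forall>T'. locally_convex M T' \<and> (\<forall>i\<in>I. continuous_map (S i) T' (h i)) \<longrightarrow>
        (\<forall>U. openin T' U \<longrightarrow> openin T U))"

definition finest_lc_topology ::
  "'v cvs \<Rightarrow> 'i set \<Rightarrow> ('i \<Rightarrow> 'w topology) \<Rightarrow> ('i \<Rightarrow> 'w \<Rightarrow> 'v) \<Rightarrow> 'v topology" where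
  "finest_lc_topology M I S h = (THE T. is_finest_lc_topology M I S h T)"

lemma is_finest_lc_topology_unique:
  assumes "is_finest_lc_topology M I S h T" "is_finest_lc_topology M I S h T'"
  shows "T = T'"
  using assms unfolding is_finest_lc_topology_def by (metis topology_eq)

lemma convex_in_Int: "convex_in M C \<Longrightarrow> convex_in M D \<Longrightarrow> convex_in M (C \<inter> D)"
  unfolding convex_in_def by blast

lemma continuous_map_indiscrete:
  assumes "f \<in> topspace P \<rightarrow> C"
  shows "continuous_map P (topology_generated_by {C}) f"
proof (rule continuous_on_generated_topo)
  fix U assume "U \<in> {C}"
  then have "f -` U \<inter> topspace P = topspace P" using assms by auto
  then show "openin P (f -` U \<inter> topspace P)" by simp
qed (use assms in auto)

lemma continuous_map_Sup_topology:
  assumes "\<And>T. T \<in> \<T> \<Longrightarrow> continuous_map P T f" "\<T> \<noteq> {}"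
  shows "continuous_map P (topology_generated_by {U. \<exists>T\<in>\<T>. openin T U}) f"
proof (rule continuous_on_generated_topo)
  fix U assume "U \<in> {U. \<exists>T\<in>\<T>. openin T U}"
  then obtain T where T: "T \<in> \<T>" "openin T U" by auto
  then have "openin P {x \<in> topspace P. f x \<in> U}"
    using assms(1)[OF T(1)] by (simp add: continuous_map_def)
  moreover have "f -` U \<inter> topspace P = {x \<in> topspace P. f x \<in> U}" by auto
  ultimately show "openin P (f -` U \<inter> topspace P)" by simp
next
  obtain T where "T \<in> \<T>" using assms(2) by auto
  with assms(1)[OF this] have "f ` topspace P \<subseteq> topspace T" "openin T (topspace T)"
    by (auto simp: continuous_map_def)
  then show "f ` topspace P \<subseteq> \<Union>{U. \<exists>T\<in>\<T>. openin T U}"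
    using \<open>T \<in> \<T>\<close> by blast
qed

lemma locally_convex_indiscrete:
  assumes "vector_space_on M"
  shows "locally_convex M (topology_generated_by {carrier M})"
proof -
  interpret M: Module.module CC M by fact
  have cc: "c \<in> carrier CC" for c
    by (simp add: ring_of_type_algebra_def)
  let ?T = "topology_generated_by {carrier M}"
  have ts: "topspace ?T = carrier M" by simp
  have conv: "convex_in M (carrier M)"
    by (auto simp: convex_in_def cc)
  have op: "U = {} \<or> U = carrier M" if "openin ?T U" for U
    using openin_topology_generated_by[OF that]
    by (induction rule: generate_topology_on.induct) auto
  have "openin ?T (carrier M)"
    by (metis openin_topspace ts)
  then have "neighbourhood_base_at \<zero>\<^bsub>M\<^esub> (convex_in M) ?T"
    unfolding neighbourhood_base_at_def using op conv by blast
  moreover have "continuous_map (prod_topology ?T ?T) ?T (\<lambda>(a, b). a \<oplus>\<^bsub>M\<^esub> b)"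
    by (rule continuous_map_indiscrete) auto
  moreover have "continuous_map (prod_topology euclidean ?T) ?T (\<lambda>(c, a). c \<odot>\<^bsub>M\<^esub> a)"
    by (rule continuous_map_indiscrete) (auto simp: cc)
  ultimately show ?thesis
    using assms ts by (simp add: locally_convex_def topological_vs_def)
qed

lemma finest_lc_topology:
  assumes M: "vector_space_on M"
    and h: "\<And>i. i \<in> I \<Longrightarrow> h i \<in> topspace (S i) \<rightarrow> carrier M"
  shows "is_finest_lc_topology M I S h (finest_lc_topology M I S h)"
proof -
  define \<T> where "\<T> = {T. locally_convex M T \<and> (\<forall>i\<in>I. continuous_map (S i) T (h i))}"
  define \<B> where "\<B> = {U. \<exists>T\<in>\<T>. openin T U}"
  define T where "T = topology_generated_by \<B>"
  have carr: "topspace T' = carrier M" if "T' \<in> \<T>" for T'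
    using that by (simp add: \<T>_def locally_convex_def topological_vs_def)
  have ind: "topology_generated_by {carrier M} \<in> \<T>"
    using locally_convex_indiscrete[OF M] h
    by (auto simp: \<T>_def intro!: continuous_map_indiscrete)
  have cB: "carrier M \<in> \<B>"
    using ind carr[OF ind] openin_topspace[of "topology_generated_by {carrier M}"]
    unfolding \<B>_def by auto
  have UB: "\<Union>\<B> = carrier M"
  proof (rule antisym)
    show "\<Union>\<B> \<subseteq> carrier M"
      using carr openin_subset unfolding \<B>_def by fastforce
  qed (use cB in auto)
  have ts: "topspace T = carrier M"
    using UB by (simp add: T_def)
  have fine: "openin T U" if "T' \<in> \<T>" "openin T' U" for T' U
    unfolding T_def using that by (auto simp: \<B>_def intro: topology_generated_by_Basis)
  have id: "continuous_map T T' (\<lambda>a. a)" if "T' \<in> \<T>" for T'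
    unfolding continuous_map_def
  proof (intro conjI allI impI)
    fix U assume U: "openin T' U"
    then have "{a \<in> topspace T. a \<in> U} = U"
      using openin_subset[OF U] carr[OF that] ts by auto
    then show "openin T {a \<in> topspace T. a \<in> U}" using fine[OF that U] by simp
  qed (use carr[OF that] ts in auto)
  have "\<T> \<noteq> {}" using ind by auto
  note toT = continuous_map_Sup_topology[where \<T> = \<T>, OF _ this,
      folded \<B>_def, folded T_def]
  have add: "continuous_map (prod_topology T T) T (\<lambda>(a, b). a \<oplus>\<^bsub>M\<^esub> b)"
  proof (rule toT)
    fix T' assume T': "T' \<in> \<T>"
    have 1: "continuous_map (prod_topology T T) (prod_topology T' T') (\<lambda>(a, b). (a, b))"
      unfolding continuous_map_prod_top using id[OF T'] by auto
    have 2: "continuous_map (prod_topology T' T') T' (\<lambda>(a, b). a \<oplus>\<^bsub>M\<^esub> b)"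
      using T' by (simp add: \<T>_def locally_convex_def topological_vs_def)
    from continuous_map_compose[OF 1 2] show "continuous_map (prod_topology T T) T' (\<lambda>(a, b). a \<oplus>\<^bsub>M\<^esub> b)"
      by (simp add: comp_def case_prod_unfold)
  qed
  have scal: "continuous_map (prod_topology euclidean T) T (\<lambda>(c, a). c \<odot>\<^bsub>M\<^esub> a)"
  proof (rule toT)
    fix T' assume T': "T' \<in> \<T>"
    have 1: "continuous_map (prod_topology euclidean T) (prod_topology euclidean T')
        (\<lambda>(a :: complex, b). (a, b))"
      unfolding continuous_map_prod_top using id[OF T'] by auto
    have 2: "continuous_map (prod_topology euclidean T') T' (\<lambda>(c, a). c \<odot>\<^bsub>M\<^esub> a)"
      using T' by (simp add: \<T>_def locally_convex_def topological_vs_def)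
    from continuous_map_compose[OF 1 2] show "continuous_map (prod_topology euclidean T) T' (\<lambda>(c, a). c \<odot>\<^bsub>M\<^esub> a)"
      by (simp add: comp_def case_prod_unfold)
  qed
  have nb: "\<exists>U V. openin T U \<and> convex_in M V \<and> \<zero>\<^bsub>M\<^esub> \<in> U \<and> U \<subseteq> V \<and> V \<subseteq> W"
    if "generate_topology_on \<B> W" "\<zero>\<^bsub>M\<^esub> \<in> W" for W
    using that
  proof (induction rule: generate_topology_on.induct)
    case (Int a b)
    then obtain U V U' V' where
      "openin T U" "convex_in M V" "\<zero>\<^bsub>M\<^esub> \<in> U" "U \<subseteq> V" "V \<subseteq> a"
      "openin T U'" "convex_in M V'" "\<zero>\<^bsub>M\<^esub> \<in> U'" "U' \<subseteq> V'" "V' \<subseteq> b"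
      by (metis IntD1 IntD2)
    then show ?case
      by (intro exI[of _ "U \<inter> U'"] exI[of _ "V \<inter> V'"]) (auto intro: convex_in_Int)
  next
    case (UN K)
    then obtain k where k: "k \<in> K" "\<zero>\<^bsub>M\<^esub> \<in> k" by auto
    from UN.IH[OF k] k(1) show ?case by (meson Sup_upper order_trans)
  next
    case (Basis W)
    then obtain T' where T': "T' \<in> \<T>" "openin T' W" by (auto simp: \<B>_def)
    then have "neighbourhood_base_at \<zero>\<^bsub>M\<^esub> (convex_in M) T'"
      by (simp add: \<T>_def locally_convex_def)
    then obtain U V where "openin T' U" "convex_in M V" "\<zero>\<^bsub>M\<^esub> \<in> U" "U \<subseteq> V" "V \<subseteq> W"
      using T'(2) Basis.prems unfolding neighbourhood_base_at_def by blast
    then show ?case using fine[OF T'(1)] by blast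
  qed simp
  have "neighbourhood_base_at \<zero>\<^bsub>M\<^esub> (convex_in M) T"
    unfolding neighbourhood_base_at_def using nb openin_topology_generated_by
    by (metis T_def)
  then have "locally_convex M T"
    using M ts add scal by (simp add: locally_convex_def topological_vs_def)
  moreover have "continuous_map (S i) T (h i)" if "i \<in> I" for i
    by (rule toT) (use that in \<open>simp add: \<T>_def\<close>)
  ultimately have T: "is_finest_lc_topology M I S h T"
    using fine by (auto simp: is_finest_lc_topology_def \<T>_def)
  show ?thesis
    unfolding finest_lc_topology_def
    by (rule theI[where P = "is_finest_lc_topology M I S h" and a = T])
      (auto intro: T is_finest_lc_topology_unique[OF _ T])
qed


section \<open>Weak integrals\<close>

text \<open>
  On the half line, which is sigma-compact, essentially integrable is the same as integrable;
  Bourbaki's measurability is measurability for the completed, i.e. Lebesgue, measure.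
\<close>

definition mu :: "real \<Rightarrow> real measure" where
  "mu l = density (lebesgue_on {0..}) (\<lambda>s. ennreal (exp (- l * s)))"

definition is_weak_integral ::
  "'v cvs \<Rightarrow> 'v topology \<Rightarrow> 'y measure \<Rightarrow> ('y \<Rightarrow> 'v) \<Rightarrow> 'v \<Rightarrow> bool" where
  "is_weak_integral M T \<mu> f z \<longleftrightarrow> z \<in> carrier M \<and>
     (\<forall>\<phi>\<in>top_dual M T. \<phi> z = (LINT s|\<mu>. \<phi> (f s)))"

definition weak_integral ::
  "'v cvs \<Rightarrow> 'v topology \<Rightarrow> 'y measure \<Rightarrow> ('y \<Rightarrow> 'v) \<Rightarrow> 'v" where
  "weak_integral M T \<mu> f = (THE z. is_weak_integral M T \<mu> f z)"

definition L1 :: "'v cvs \<Rightarrow> 'v topology \<Rightarrow> 'y measure \<Rightarrow> ('y \<Rightarrow> 'v) set" where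
  "L1 M T \<mu> = {f \<in> space \<mu> \<rightarrow>\<^sub>E carrier M.
     (\<forall>\<phi>\<in>top_dual M T. integrable \<mu> (\<lambda>s. \<phi> (f s))) \<and> (\<exists>z. is_weak_integral M T \<mu> f z)}"


section \<open>Bundles\<close>

record ('e, 'x) omega_bundle =
  total_top :: "'e topology"
  proj :: "'e \<Rightarrow> 'x"
  base_top :: "'x topology"
  fib_add :: "'e \<Rightarrow> 'e \<Rightarrow> 'e"
  fib_smult :: "complex \<Rightarrow> 'e \<Rightarrow> 'e"
  fib_zero :: "'x \<Rightarrow> 'e"
  seminorms :: "('e \<Rightarrow> real) set"

definition stalk :: "('e, 'x) omega_bundle \<Rightarrow> 'x \<Rightarrow> 'e cvs" where
  "stalk V x = \<lparr>carrier = {e \<in> topspace (total_top V). proj V e = x},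
     monoid.mult = undefined, one = undefined,
     ring.zero = fib_zero V x, ring.add = fib_add V, module.smult = fib_smult V\<rparr>"

definition stalk_top :: "('e, 'x) omega_bundle \<Rightarrow> 'x \<Rightarrow> 'e topology" where
  "stalk_top V x = subtopology (total_top V) (carrier (stalk V x))"

definition bounded_sections :: "('e, 'x) omega_bundle \<Rightarrow> 'x set \<Rightarrow> ('x \<Rightarrow> 'e) set" where
  "bounded_sections V U = {\<sigma> \<in> extensional U.
     continuous_map (subtopology (base_top V) U) (total_top V) \<sigma> \<and>
     (\<forall>x\<in>U. proj V (\<sigma> x) = x) \<and>
     (\<forall>\<nu>\<in>seminorms V. bdd_above ((\<lambda>x. \<nu> (\<sigma> x)) ` U))}"

definition Gamma_sec :: "('e, 'x) omega_bundle \<Rightarrow> ('x \<Rightarrow> 'e) set" where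
  "Gamma_sec V = bounded_sections V (topspace (base_top V))"

definition tubes :: "('e, 'x) omega_bundle \<Rightarrow> 'e set set" where
  "tubes V = {{\<beta> \<in> topspace (total_top V). proj V \<beta> \<in> U \<and>
                \<nu> (\<beta> \<ominus>\<^bsub>stalk V (proj V \<beta>)\<^esub> \<sigma> (proj V \<beta>)) < \<epsilon>} | U \<sigma> \<epsilon> \<nu>.
     openin (base_top V) U \<and> \<sigma> \<in> bounded_sections V U \<and> 0 < \<epsilon> \<and> \<nu> \<in> seminorms V}"

definition bundle_of_Omega_spaces :: "('e, 'x) omega_bundle \<Rightarrow> bool" where
  "bundle_of_Omega_spaces V \<longleftrightarrow>
     continuous_map (total_top V) (base_top V) (proj V) \<and>
     open_map (total_top V) (base_top V) (proj V) \<and>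
     proj V ` topspace (total_top V) = topspace (base_top V) \<and>
     (\<forall>x\<in>topspace (base_top V). vector_space_on (stalk V x)) \<and>
     continuous_map
       (subtopology (prod_topology (total_top V) (total_top V)) {(a, b). proj V a = proj V b})
       (total_top V) (\<lambda>(a, b). fib_add V a b) \<and>
     continuous_map (prod_topology euclidean (total_top V)) (total_top V)
       (\<lambda>(c, a). fib_smult V c a) \<and>
     (\<forall>x\<in>topspace (base_top V).
        (\<forall>\<nu>\<in>seminorms V. seminorm_on (stalk V x) \<nu>) \<and>
        (\<forall>\<nu>\<in>seminorms V. \<forall>\<nu>'\<in>seminorms V. \<exists>\<nu>''\<in>seminorms V.
           \<forall>e\<in>carrier (stalk V x). \<nu> e \<le> \<nu>'' e \<and> \<nu>' e \<le> \<nu>'' e) \<and>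
        stalk_top V x = seminorm_topology (stalk V x) (seminorms V) \<and>
        Hausdorff_space (stalk_top V x)) \<and>
     openin (total_top V) = arbitrary union_of (\<lambda>A. A \<in> tubes V)"


section \<open>Structures of operator-valued functions over a bundle\<close>

text \<open>Supremum in the extended half line: the supremum of the empty set is 0.\<close>

definition sup0 :: "real set \<Rightarrow> real" where
  "sup0 A = Sup (insert 0 A)"

definition D_sections ::
  "('e, 'x) omega_bundle \<Rightarrow> ('x \<Rightarrow> 'e set) \<Rightarrow> ('x \<Rightarrow> 'e) set \<Rightarrow> ('x \<Rightarrow> 'e) set" where
  "D_sections V B \<E> = \<E> \<inter> (\<Pi>\<^sub>E x\<in>topspace (base_top V). B x)"

definition B_set ::
  "('e, 'x) omega_bundle \<Rightarrow> ('x \<Rightarrow> 'e) set \<Rightarrow> ('x \<Rightarrow> 'e set) \<Rightarrow> 'x \<Rightarrow> 'e set" where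
  "B_set V \<E> B x = {v x | v. v \<in> D_sections V B \<E>}"

definition Lx :: "('e, 'x) omega_bundle \<Rightarrow> 'x \<Rightarrow> ('e \<Rightarrow> 'e) cvs" where
  "Lx V x = endo_space (stalk V x) (stalk_top V x)"

text \<open>
  The topology of uniform convergence on the sets \<^term>\<open>B_set V \<E> B x\<close>, for \<open>B\<close> in \<open>\<Theta>\<close>.
\<close>

definition LS_top ::
  "('e, 'x) omega_bundle \<Rightarrow> ('x \<Rightarrow> 'e) set \<Rightarrow> ('x \<Rightarrow> 'e set) set \<Rightarrow> 'x \<Rightarrow> ('e \<Rightarrow> 'e) topology" where
  "LS_top V \<E> \<Theta> x = seminorm_topology (Lx V x)
     {\<lambda>f. sup0 ((\<lambda>b. \<nu> (f b)) ` B_set V \<E> B x) | \<nu> B. \<nu> \<in> seminorms V \<and> B \<in> \<Theta>}"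

definition q_seminorm ::
  "('e, 'x) omega_bundle \<Rightarrow> ('x \<Rightarrow> 'e) set \<Rightarrow> 'x \<Rightarrow> 'y set \<times> ('e \<Rightarrow> real) \<times> ('x \<Rightarrow> 'e set)
     \<Rightarrow> ('y \<Rightarrow> 'e \<Rightarrow> 'e) \<Rightarrow> real" where
  "q_seminorm V \<E> x = (\<lambda>(K, \<nu>, B) f.
     sup0 ((\<lambda>t. sup0 ((\<lambda>v. \<nu> (f t (v x))) ` D_sections V B \<E>)) ` K))"

text \<open>
  The bundle with stalks \<open>\<MM> x\<close>: its total space is the disjoint union of the \<open>\<MM> x\<close>, realised
  as a set of pairs, with topology \<open>\<gamma>\<close>, and its linear operations are pointwise. The seminorms
  of \<open>V\<close> serve as their own indices.
\<close>

definition op_bundle ::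
  "('e, 'x) omega_bundle \<Rightarrow> ('x \<Rightarrow> 'e) set \<Rightarrow> ('x \<Rightarrow> 'e set) set \<Rightarrow> 'y topology \<Rightarrow>
     ('x \<times> ('y \<Rightarrow> 'e \<Rightarrow> 'e)) topology \<Rightarrow> ('x \<times> ('y \<Rightarrow> 'e \<Rightarrow> 'e), 'x) omega_bundle" where
  "op_bundle V \<E> \<Theta> Y \<gamma> = \<lparr>total_top = \<gamma>, proj = fst, base_top = base_top V,
     fib_add = (\<lambda>(x, f) (_, g). (x, f \<oplus>\<^bsub>prod_space (topspace Y) (\<lambda>_. Lx V x)\<^esub> g)),
     fib_smult = (\<lambda>c (x, f). (x, c \<odot>\<^bsub>prod_space (topspace Y) (\<lambda>_. Lx V x)\<^esub> f)),
     fib_zero = (\<lambda>x. (x, \<zero>\<^bsub>prod_space (topspace Y) (\<lambda>_. Lx V x)\<^esub>)),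
     seminorms = {\<lambda>(x, f). sup0 ((\<lambda>i. q_seminorm V \<E> x i f) ` Q) | Q.
       finite Q \<and> Q \<subseteq> {K. compactin Y K} \<times> seminorms V \<times> \<Theta>}\<rparr>"

definition Theta_E_structure ::
  "('e, 'x) omega_bundle \<Rightarrow> ('x \<Rightarrow> 'e) set \<Rightarrow> ('x \<Rightarrow> 'e set) set \<Rightarrow> 'y topology \<Rightarrow>
     ('x \<Rightarrow> ('y \<Rightarrow> 'e \<Rightarrow> 'e) set) \<Rightarrow> ('x \<times> ('y \<Rightarrow> 'e \<Rightarrow> 'e)) topology \<Rightarrow> bool" where
  "Theta_E_structure V \<E> \<Theta> Y \<MM> \<gamma> \<longleftrightarrow>
     bundle_of_Omega_spaces V \<and> Hausdorff_space Y \<and>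
     \<E> \<subseteq> Gamma_sec V \<and>
     \<Theta> \<subseteq> (\<Pi>\<^sub>E x\<in>topspace (base_top V). bounded_sets (stalk V x) (stalk_top V x)) \<and>
     (\<forall>B\<in>\<Theta>. D_sections V B \<E> \<noteq> {}) \<and>
     (\<forall>x\<in>topspace (base_top V).
        total_in (stalk V x) (stalk_top V x) (\<Union>B\<in>\<Theta>. B_set V \<E> B x)) \<and>
     (\<forall>x\<in>topspace (base_top V).
        linear_subspace (\<MM> x) (cts_fun_space Y (Lx V x) (LS_top V \<E> \<Theta> x))) \<and>
     topspace \<gamma> = Sigma (topspace (base_top V)) \<MM> \<and>
     bundle_of_Omega_spaces (op_bundle V \<E> \<Theta> Y \<gamma>)"

text \<open>A section of \<^const>\<open>op_bundle\<close> at \<open>x\<close> is a pair, of which \<^const>\<open>snd\<close> is the element of \<open>\<MM> x\<close>.\<close>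

definition LD ::
  "('e, 'x) omega_bundle \<Rightarrow> ('x \<Rightarrow> 'e) set \<Rightarrow> ('x \<Rightarrow> 'e set) set \<Rightarrow>
     ('x \<Rightarrow> 'x \<times> (real \<Rightarrow> 'e \<Rightarrow> 'e)) set \<Rightarrow> ('x \<Rightarrow> 'e) set \<Rightarrow> bool" where
  "LD V \<E> \<Theta> \<O> \<D> \<longleftrightarrow> (\<forall>l>0. \<forall>H\<in>\<O>. \<forall>w\<in>\<D>.
     (\<lambda>x\<in>topspace (base_top V).
        weak_integral (Lx V x) (LS_top V \<E> \<Theta> x) (mu l) (snd (H x)) (w x)) \<in> Gamma_sec V)"


section \<open>Consistent classes of data\<close>

definition theta_map ::
  "'x set \<Rightarrow> ('x \<Rightarrow> 'e cvs) \<Rightarrow> ('x \<Rightarrow> 'e \<Rightarrow> 'e) \<Rightarrow> ('x \<Rightarrow> 'e) \<Rightarrow> ('x \<Rightarrow> 'e)" where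
  "theta_map I E u = (\<lambda>f\<in>carrier (prod_space I E). \<lambda>x\<in>I. u x (f x))"

definition H_space :: "'x set \<Rightarrow> ('x \<Rightarrow> 'e cvs) \<Rightarrow> ('x \<Rightarrow> 'e) set \<Rightarrow> ('x \<Rightarrow> 'e) cvs" where
  "H_space I E \<H> = subspace_of (prod_space I E) \<H>"

definition consistent_data ::
  "'x set \<Rightarrow> ('x \<Rightarrow> 'e cvs) \<Rightarrow> ('x \<Rightarrow> 'e topology) \<Rightarrow>
     ('x \<Rightarrow> 'e) set \<Rightarrow> ('x \<Rightarrow> 'e) topology \<Rightarrow> ('x \<Rightarrow> 'e \<Rightarrow> 'e) set \<Rightarrow> bool" where
  "consistent_data I E TE \<H> \<TT> \<A> \<longleftrightarrow>
     linear_subspace \<H> (prod_space I E) \<and> Hlcs (H_space I E \<H>) \<TT> \<and>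
     (\<forall>x\<in>I. inj_factor I E x ` carrier (E x) \<subseteq> \<H> \<and>
        continuous_map \<TT> (TE x) (\<lambda>f. f x) \<and>
        continuous_map (TE x) \<TT> (inj_factor I E x)) \<and>
     linear_subspace \<A> (prod_space I (\<lambda>x. endo_space (E x) (TE x))) \<and>
     (\<forall>u\<in>\<A>. restrict (theta_map I E u) \<H> \<in> continuous_endos (H_space I E \<H>) \<TT>) \<and>
     (\<forall>x\<in>I. inj_factor I (\<lambda>x. endo_space (E x) (TE x)) x ` continuous_endos (E x) (TE x) \<subseteq> \<A>)"

definition h_map ::
  "'x set \<Rightarrow> ('x \<Rightarrow> 'e cvs) \<Rightarrow> ('x \<Rightarrow> 'e) set \<Rightarrow> 'x \<Rightarrow> ('e \<Rightarrow> 'e) \<Rightarrow> ('x \<Rightarrow> 'e) \<Rightarrow> ('x \<Rightarrow> 'e)" where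
  "h_map I E \<H> x f = (\<lambda>v\<in>\<H>. inj_factor I E x (f (v x)))"

definition G_space ::
  "'x set \<Rightarrow> ('x \<Rightarrow> 'e cvs) \<Rightarrow> ('x \<Rightarrow> 'e) set \<Rightarrow> ('x \<Rightarrow> 'e \<Rightarrow> 'e) set \<Rightarrow>
     (('x \<Rightarrow> 'e) \<Rightarrow> ('x \<Rightarrow> 'e)) cvs" where
  "G_space I E \<H> \<A> = subspace_of (prod_space \<H> (\<lambda>_. H_space I E \<H>))
     ((\<lambda>u. restrict (theta_map I E u) \<H>) ` \<A>)"

text \<open>Here \<open>TL x\<close> is the given topology on the continuous endomorphisms of \<open>E x\<close>.\<close>

definition G_top ::
  "'x set \<Rightarrow> ('x \<Rightarrow> 'e cvs) \<Rightarrow> ('x \<Rightarrow> ('e \<Rightarrow> 'e) topology) \<Rightarrow> ('x \<Rightarrow> 'e) set \<Rightarrow>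
     ('x \<Rightarrow> 'e \<Rightarrow> 'e) set \<Rightarrow> (('x \<Rightarrow> 'e) \<Rightarrow> ('x \<Rightarrow> 'e)) topology" where
  "G_top I E TL \<H> \<A> = finest_lc_topology (G_space I E \<H> \<A>) I TL (h_map I E \<H>)"

definition Psi ::
  "'x set \<Rightarrow> ('x \<Rightarrow> 'e cvs) \<Rightarrow> 'y set \<Rightarrow> ('y \<Rightarrow> ('x \<Rightarrow> 'e) \<Rightarrow> ('x \<Rightarrow> 'e)) \<Rightarrow> 'x \<Rightarrow> 'y \<Rightarrow> 'e \<Rightarrow> 'e" where
  "Psi I E Y F = (\<lambda>x\<in>I. \<lambda>s\<in>Y. \<lambda>e\<in>carrier (E x). F s (inj_factor I E x e) x)"

text \<open>An element of the product of the stalks, as a section of \<^const>\<open>op_bundle\<close>.\<close>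

definition as_section :: "'x set \<Rightarrow> ('x \<Rightarrow> 'm) \<Rightarrow> 'x \<Rightarrow> 'x \<times> 'm" where
  "as_section I H = (\<lambda>x\<in>I. (x, H x))"

end

theory Submission
  imports Defs
begin

text \<open>
  Let \<open>T\<^sub>x g\<close> be the operator \<open>e \<mapsto> (g (\<iota>\<^sub>x e)) x\<close> on the stalk at \<open>x\<close>. Since \<open>T\<^sub>x \<circ> h\<^sub>y\<close> is the
  identity for \<open>y = x\<close> and zero otherwise, \<open>\<phi> \<circ> T\<^sub>x\<close> is continuous on \<open>\<GG>\<close> for every continuous
  linear form \<open>\<phi>\<close> on the operators of the stalk, by the universal property of the finest locally
  convex topology. Hence \<open>T\<^sub>x\<close> maps the weak integral of \<open>F\<close> to a weak integral of
  \<open>s \<mapsto> T\<^sub>x (F s) = \<Psi> F x s\<close>, and the section in the definition of LD is the integral of \<open>F\<close>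
  applied to \<open>v\<close>.

  The integrals are determined by their defining property because the linear forms
  \<open>f \<mapsto> \<psi> (f b)\<close>, with \<open>b\<close> in the total set and \<open>\<psi>\<close> provided by the Hahn-Banach theorem,
  separate the operators of a stalk, and the maps \<open>T\<^sub>x\<close> separate \<open>\<GG>\<close>.
\<close>

section \<open>Complex vector spaces\<close>

text \<open>Unfolding \<open>CC\<close> once turns the module axioms into rules stated in ordinary
  complex arithmetic.\<close>

locale complex_vs = Module.module CC M for M :: "'v cvs" (structure)
begin

lemma smult_in: "x \<in> carrier M \<Longrightarrow> c \<odot> x \<in> carrier M"
  by (simp add: ring_of_type_algebra_def)

lemma smult_add_left: "x \<in> carrier M \<Longrightarrow> (c + d) \<odot> x = c \<odot> x \<oplus> d \<odot> x"
  using smult_l_distr[of c d x] by (simp add: ring_of_type_algebra_def)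

lemma smult_add_right:
  "x \<in> carrier M \<Longrightarrow> y \<in> carrier M \<Longrightarrow> c \<odot> (x \<oplus> y) = c \<odot> x \<oplus> c \<odot> y"
  using smult_r_distr[of c x y] by (simp add: ring_of_type_algebra_def)

lemma smult_smult: "x \<in> carrier M \<Longrightarrow> c \<odot> (d \<odot> x) = (c * d) \<odot> x"
  using smult_assoc1[of c d x] by (simp add: ring_of_type_algebra_def)

lemma smult_1: "x \<in> carrier M \<Longrightarrow> 1 \<odot> x = x"
  using smult_one[of x] by (simp add: ring_of_type_algebra_def)

lemma smult_0: "x \<in> carrier M \<Longrightarrow> 0 \<odot> x = \<zero>"
  using smult_l_null[of x] by (simp add: ring_of_type_algebra_def)

lemma smult_zero: "c \<odot> \<zero> = \<zero>"
  using smult_r_null[of c] by (simp add: ring_of_type_algebra_def)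

lemma smult_minus1: "x \<in> carrier M \<Longrightarrow> (-1) \<odot> x = \<ominus> x"
  using smult_add_left[of x "-1" 1]
  by (simp add: smult_0 smult_1 smult_in M.minus_equality)

lemmas vs_simps = smult_in smult_add_left smult_add_right smult_smult smult_1 smult_0 smult_zero

lemma linear_subspaceI:
  assumes "W \<subseteq> carrier M" "W \<noteq> {}"
    and add: "\<And>a b. a \<in> W \<Longrightarrow> b \<in> W \<Longrightarrow> a \<oplus> b \<in> W"
    and smult: "\<And>c a. a \<in> W \<Longrightarrow> c \<odot> a \<in> W"
  shows "linear_subspace W M"
proof (rule submoduleI)
  obtain a where a: "a \<in> W" using assms(2) by blast
  then have "0 \<odot> a = \<zero>" using assms(1) smult_0 by blast
  then show "\<zero> \<in> W" using smult[OF a, of 0] by simp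
  show "\<ominus> a \<in> W" if "a \<in> W" for a
    using smult[OF that, of "-1"] that assms(1) by (simp add: subsetD smult_minus1)
qed (use assms in auto)

end

lemma vector_space_on_iff: "vector_space_on M \<longleftrightarrow> complex_vs M"
  by (simp add: complex_vs_def)

text \<open>Additive inverses come from the scalar \<open>-1\<close>, by distributivity over
  \<open>-1 + 1\<close> and the last assumption.\<close>

lemma vector_space_onI:
  fixes M :: "'v cvs"
  assumes "\<And>x y. x \<in> carrier M \<Longrightarrow> y \<in> carrier M \<Longrightarrow> x \<oplus>\<^bsub>M\<^esub> y \<in> carrier M"
    and "\<zero>\<^bsub>M\<^esub> \<in> carrier M"
    and "\<And>x y z. x \<in> carrier M \<Longrightarrow> y \<in> carrier M \<Longrightarrow> z \<in> carrier M \<Longrightarrow>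
      (x \<oplus>\<^bsub>M\<^esub> y) \<oplus>\<^bsub>M\<^esub> z = x \<oplus>\<^bsub>M\<^esub> (y \<oplus>\<^bsub>M\<^esub> z)"
    and "\<And>x y. x \<in> carrier M \<Longrightarrow> y \<in> carrier M \<Longrightarrow> x \<oplus>\<^bsub>M\<^esub> y = y \<oplus>\<^bsub>M\<^esub> x"
    and "\<And>x. x \<in> carrier M \<Longrightarrow> \<zero>\<^bsub>M\<^esub> \<oplus>\<^bsub>M\<^esub> x = x"
    and "\<And>c x. x \<in> carrier M \<Longrightarrow> c \<odot>\<^bsub>M\<^esub> x \<in> carrier M"
    and "\<And>c d x. x \<in> carrier M \<Longrightarrow> (c + d) \<odot>\<^bsub>M\<^esub> x = c \<odot>\<^bsub>M\<^esub> x \<oplus>\<^bsub>M\<^esub> d \<odot>\<^bsub>M\<^esub> x"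
    and "\<And>c x y. x \<in> carrier M \<Longrightarrow> y \<in> carrier M \<Longrightarrow>
      c \<odot>\<^bsub>M\<^esub> (x \<oplus>\<^bsub>M\<^esub> y) = c \<odot>\<^bsub>M\<^esub> x \<oplus>\<^bsub>M\<^esub> c \<odot>\<^bsub>M\<^esub> y"
    and "\<And>c d x. x \<in> carrier M \<Longrightarrow> (c * d) \<odot>\<^bsub>M\<^esub> x = c \<odot>\<^bsub>M\<^esub> (d \<odot>\<^bsub>M\<^esub> x)"
    and "\<And>x. x \<in> carrier M \<Longrightarrow> 1 \<odot>\<^bsub>M\<^esub> x = x"
    and "\<And>x. x \<in> carrier M \<Longrightarrow> 0 \<odot>\<^bsub>M\<^esub> x = \<zero>\<^bsub>M\<^esub>"
  shows "vector_space_on M"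
proof (rule moduleI)
  show "abelian_group M"
  proof (rule abelian_groupI)
    fix x assume x: "x \<in> carrier M"
    have "(-1) \<odot>\<^bsub>M\<^esub> x \<oplus>\<^bsub>M\<^esub> x = \<zero>\<^bsub>M\<^esub>"
      using assms(7)[OF x, of "-1" 1] x assms(10,11) by simp
    then show "\<exists>y\<in>carrier M. y \<oplus>\<^bsub>M\<^esub> x = \<zero>\<^bsub>M\<^esub>"
      using assms(6)[OF x] by blast
  qed (use assms in auto)
  show "cring CC"
    by (rule cring_from_type_algebra)
qed (use assms in \<open>auto simp: ring_of_type_algebra_def\<close>)

lemma vector_space_on_prod_space:
  assumes "\<And>i. i \<in> I \<Longrightarrow> vector_space_on (N i)"
  shows "vector_space_on (prod_space I N)"
proof -
  have N: "complex_vs (N i)" if "i \<in> I" for i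
    using assms[OF that] by (simp add: vector_space_on_iff)
  have A: "abelian_group (N i)" if "i \<in> I" for i
    using N[OF that] by (simp add: complex_vs_def Module.module_def)
  note ag = abelian_monoid.a_closed[OF abelian_group.axioms(1)[OF A]]
    abelian_monoid.zero_closed[OF abelian_group.axioms(1)[OF A]]
    abelian_monoid.a_assoc[OF abelian_group.axioms(1)[OF A]]
    abelian_monoid.l_zero[OF abelian_group.axioms(1)[OF A]]
  note vs = complex_vs.smult_in[OF N] complex_vs.smult_add_left[OF N]
    complex_vs.smult_add_right[OF N] complex_vs.smult_smult[OF N] complex_vs.smult_1[OF N]
    complex_vs.smult_0[OF N]
  show ?thesis
  proof (rule vector_space_onI)
    fix f g assume "f \<in> carrier (prod_space I N)" "g \<in> carrier (prod_space I N)"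
    then show "f \<oplus>\<^bsub>prod_space I N\<^esub> g = g \<oplus>\<^bsub>prod_space I N\<^esub> f"
      by (auto simp: prod_space_def PiE_iff fun_eq_iff
          intro: abelian_monoid.a_comm[OF abelian_group.axioms(1)[OF A]])
  next
    fix f assume "f \<in> carrier (prod_space I N)"
    then show "1 \<odot>\<^bsub>prod_space I N\<^esub> f = f"
      using vs(5) by (auto simp: prod_space_def PiE_iff fun_eq_iff extensional_def)
  next
    fix f assume "f \<in> carrier (prod_space I N)"
    then show "\<zero>\<^bsub>prod_space I N\<^esub> \<oplus>\<^bsub>prod_space I N\<^esub> f = f"
      using ag by (auto simp: prod_space_def PiE_iff fun_eq_iff extensional_def)
  qed (auto simp: prod_space_def PiE_iff fun_eq_iff ag vs)
qed

lemma vector_space_on_subspace: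
  assumes "vector_space_on M" "linear_subspace W M"
  shows "vector_space_on (subspace_of M W)"
  using submodule.submodule_is_module[OF assms(2,1)] .

section \<open>The Hahn-Banach theorem\<close>

definition sublinear_on :: "'v cvs \<Rightarrow> ('v \<Rightarrow> real) \<Rightarrow> bool" where
  "sublinear_on M q \<longleftrightarrow>
     (\<forall>a\<in>carrier M. \<forall>b\<in>carrier M. q (a \<oplus>\<^bsub>M\<^esub> b) \<le> q a + q b) \<and>
     (\<forall>t>0. \<forall>a\<in>carrier M. q (complex_of_real t \<odot>\<^bsub>M\<^esub> a) = t * q a)"

text \<open>
  Tilting stays sublinear and decreases \<open>q\<close>, so a minimal sublinear functional is fixed by all
  tilts and is therefore additive. The infimum runs over \<open>t > 0\<close>, since homogeneity is only
  required for positive scalars.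
\<close>

definition tilt :: "'v cvs \<Rightarrow> ('v \<Rightarrow> real) \<Rightarrow> 'v \<Rightarrow> 'v \<Rightarrow> real" where
  "tilt M q y = (\<lambda>x\<in>carrier M.
     INF t\<in>{0<..}. q (x \<oplus>\<^bsub>M\<^esub> complex_of_real t \<odot>\<^bsub>M\<^esub> y) - t * q y)"

context complex_vs
begin

text \<open>The inequality for \<open>inverse t\<close>, taken at the vector scaled by
  \<open>t\<close>, is the reverse of the inequality for \<open>t\<close>, so one direction of
  homogeneity gives both.\<close>

lemma sublinear_onI:
  assumes "\<And>a b. a \<in> carrier M \<Longrightarrow> b \<in> carrier M \<Longrightarrow> q (a \<oplus> b) \<le> q a + q b"
    and le: "\<And>t a. t > 0 \<Longrightarrow> a \<in> carrier M \<Longrightarrow> q (complex_of_real t \<odot> a) \<le> t * q a"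
  shows "sublinear_on M q"
  unfolding sublinear_on_def
proof (intro conjI ballI allI impI)
  fix t :: real and a assume t: "0 < t" and a: "a \<in> carrier M"
  have "q a \<le> inverse t * q (complex_of_real t \<odot> a)"
    using le[of "inverse t" "complex_of_real t \<odot> a"] t a
    by (simp add: vs_simps)
  then have "t * q a \<le> q (complex_of_real t \<odot> a)"
    using t by (simp add: field_simps)
  with le[OF t a] show "q (complex_of_real t \<odot> a) = t * q a" by simp
qed (use assms in auto)

text \<open>Homogeneity is available for positive scalars only, so the value at zero comes from
  doubling the zero vector.\<close>

lemma sublinear_on_zero:
  assumes "sublinear_on M q" shows "q \<zero> = 0"
proof -
  have "q (complex_of_real 2 \<odot> \<zero>) = 2 * q \<zero>"
    using assms unfolding sublinear_on_def by (meson M.zero_closed zero_less_numeral)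
  then show ?thesis by (simp add: smult_zero)
qed

lemma sublinear_on_lower:
  assumes "sublinear_on M q" "x \<in> carrier M" shows "- q (\<ominus> x) \<le> q x"
proof -
  have "q (x \<oplus> \<ominus> x) \<le> q x + q (\<ominus> x)"
    using assms by (simp add: sublinear_on_def)
  then show ?thesis using sublinear_on_zero[OF assms(1)] assms(2) by (simp add: M.r_neg)
qed

text \<open>The term \<open>t = 1\<close> of the infimum gives both upper bounds. For a minimal
  \<open>q\<close>, which equals its tilts, the second bound is superadditivity.\<close>

lemma
  assumes q: "sublinear_on M q" and y: "y \<in> carrier M"
  shows sublinear_on_tilt: "sublinear_on M (tilt M q y)"
    and tilt_le: "\<And>x. x \<in> carrier M \<Longrightarrow> tilt M q y x \<le> q x"
    and tilt_le_diff: "\<And>x. x \<in> carrier M \<Longrightarrow> tilt M q y x \<le> q (x \<oplus> y) - q y"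
proof -
  have sub: "q (a \<oplus> b) \<le> q a + q b" if "a \<in> carrier M" "b \<in> carrier M" for a b
    using q that by (simp add: sublinear_on_def)
  have hom: "q (complex_of_real t \<odot> a) = t * q a" if "t > 0" "a \<in> carrier M" for t a
    using q that by (simp add: sublinear_on_def)
  let ?g = "\<lambda>x t. q (x \<oplus> complex_of_real t \<odot> y) - t * q y"
  \<comment> \<open>A lower bound independent of \<open>t\<close>, so that the infimum in
    \<open>tilt\<close> is over a set bounded below.\<close>
  have low: "- q (\<ominus> x) \<le> ?g x t" if "x \<in> carrier M" "t > 0" for x t
  proof -
    have "complex_of_real t \<odot> y = \<ominus> x \<oplus> (x \<oplus> complex_of_real t \<odot> y)"
      using that y by (simp add: smult_in M.r_neg1)
    then have "q (complex_of_real t \<odot> y) \<le> q (\<ominus> x) + q (x \<oplus> complex_of_real t \<odot> y)"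
      using sub[of "\<ominus> x" "x \<oplus> complex_of_real t \<odot> y"] that y by (simp add: smult_in)
    then show ?thesis using hom[OF that(2) y] by simp
  qed
  have le: "tilt M q y x \<le> ?g x t" if "x \<in> carrier M" "t > 0" for x t
    unfolding tilt_def using that low[OF that(1)]
    by (auto intro!: cINF_lower bdd_belowI2[where m = "- q (\<ominus> x)"])
  have ge: "m \<le> tilt M q y x" if "x \<in> carrier M" "\<And>t. t > 0 \<Longrightarrow> m \<le> ?g x t" for x m
    unfolding tilt_def using that by (auto intro!: cINF_greatest)
  show "tilt M q y x \<le> q x" if x: "x \<in> carrier M" for x
    using le[OF x, of 1] sub[OF x y] y by (simp add: smult_1)
  show "tilt M q y x \<le> q (x \<oplus> y) - q y" if x: "x \<in> carrier M" for x
    using le[OF x, of 1] y by (simp add: smult_1)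
  show "sublinear_on M (tilt M q y)"
  proof (rule sublinear_onI)
    fix a b assume ab: "a \<in> carrier M" "b \<in> carrier M"
    \<comment> \<open>Parameters add: the term for \<open>a \<oplus> b\<close> at
      \<open>s + t\<close> is at most the term for \<open>a\<close> at \<open>s\<close> plus the
      term for \<open>b\<close> at \<open>t\<close>. The infima over \<open>t\<close> and
      \<open>s\<close> are then taken one after the other.\<close>
    have 1: "tilt M q y (a \<oplus> b) \<le> ?g a s + ?g b t" if st: "s > 0" "t > 0" for s t
    proof -
      have e: "(a \<oplus> b) \<oplus> complex_of_real (s + t) \<odot> y =
          (a \<oplus> complex_of_real s \<odot> y) \<oplus> (b \<oplus> complex_of_real t \<odot> y)"
        using ab y by (simp add: vs_simps M.add.m_ac)
      have "tilt M q y (a \<oplus> b) \<le> ?g (a \<oplus> b) (s + t)"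
        using le[of "a \<oplus> b" "s + t"] ab st by simp
      also have "\<dots> \<le> ?g a s + ?g b t"
        unfolding e using sub[of "a \<oplus> complex_of_real s \<odot> y" "b \<oplus> complex_of_real t \<odot> y"] ab y
        by (simp add: smult_in algebra_simps)
      finally show ?thesis .
    qed
    have "tilt M q y (a \<oplus> b) - ?g a s \<le> tilt M q y b" if "s > 0" for s
      using 1[OF that] by (intro ge[OF ab(2)]) (simp add: algebra_simps)
    then have "tilt M q y (a \<oplus> b) - tilt M q y b \<le> tilt M q y a"
      by (intro ge[OF ab(1)]) (simp add: algebra_simps)
    then show "tilt M q y (a \<oplus> b) \<le> tilt M q y a + tilt M q y b" by simp
  next
    fix r :: real and a assume r: "r > 0" and a: "a \<in> carrier M"
    have "tilt M q y (complex_of_real r \<odot> a) / r \<le> ?g a t" if t: "t > 0" for t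
    proof -
      have e: "complex_of_real r \<odot> a \<oplus> complex_of_real (r * t) \<odot> y =
          complex_of_real r \<odot> (a \<oplus> complex_of_real t \<odot> y)"
        using a y by (simp add: vs_simps)
      have "tilt M q y (complex_of_real r \<odot> a) \<le> ?g (complex_of_real r \<odot> a) (r * t)"
        using le[of "complex_of_real r \<odot> a" "r * t"] a r t by (simp add: smult_in)
      also have "\<dots> = r * ?g a t"
        unfolding e using hom[OF r, of "a \<oplus> complex_of_real t \<odot> y"] a y
        by (simp add: smult_in algebra_simps)
      finally show ?thesis using r by (subst pos_divide_le_eq) (simp_all add: mult.commute)
    qed
    then have "tilt M q y (complex_of_real r \<odot> a) / r \<le> tilt M q y a"
      by (rule ge[OF a])
    then show "tilt M q y (complex_of_real r \<odot> a) \<le> r * tilt M q y a"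
      using r by (simp add: pos_divide_le_eq mult.commute)
  qed
qed

text \<open>Zorn's lemma for the reversed pointwise order: \<open>P f g\<close> says that
  \<open>g\<close> lies below \<open>f\<close>, so a maximal element is a minimal functional.
  Nonempty chains are bounded by their pointwise infima.\<close>

lemma minimal_sublinear_exists:
  assumes p: "sublinear_on M p"
  obtains q where "sublinear_on M q" "\<And>x. x \<in> carrier M \<Longrightarrow> q x \<le> p x"
    "\<And>q' x. sublinear_on M q' \<Longrightarrow> (\<And>x. x \<in> carrier M \<Longrightarrow> q' x \<le> q x) \<Longrightarrow>
       x \<in> carrier M \<Longrightarrow> q' x = q x"
proof -
  \<comment> \<open>Extensionality turns equality on the carrier into equality of functions, as
    antisymmetry requires.\<close>
  define A where "A = {q \<in> extensional (carrier M). sublinear_on M q \<and> (\<forall>x\<in>carrier M. q x \<le> p x)}"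
  define P where "P = (\<lambda>f g :: 'v \<Rightarrow> real. \<forall>x\<in>carrier M. g x \<le> f x)"
  have sub_restrict: "sublinear_on M (restrict q (carrier M)) \<longleftrightarrow> sublinear_on M q" for q
    by (auto simp: sublinear_on_def smult_in)
  \<comment> \<open>One lower bound for all of \<open>A\<close>; it makes the pointwise infimum of a
    chain meaningful.\<close>
  have low: "- p (\<ominus> x) \<le> f x" if "f \<in> A" "x \<in> carrier M" for f x
  proof -
    have "- f (\<ominus> x) \<le> f x" "f (\<ominus> x) \<le> p (\<ominus> x)"
      using that sublinear_on_lower[of f x] by (auto simp: A_def)
    then show ?thesis by simp
  qed
  have "\<exists>m\<in>A. \<forall>a\<in>A. P m a \<longrightarrow> a = m"
  proof (rule predicate_Zorn)
    show "partial_order_on A (relation_of P A)"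
    proof (rule partial_order_on_relation_ofI)
      show "P a a" for a by (simp add: P_def)
      show "P a c" if "P a b" "P b c" for a b c
        using that order_trans unfolding P_def by blast
      show "a = b" if "a \<in> A" "b \<in> A" "P a b" "P b a" for a b
        using that unfolding P_def A_def
        by (intro extensionalityI[of a "carrier M" b]) (auto intro: antisym)
    qed
    fix C assume "C \<in> Chains (relation_of P A)"
    then have CA: "C \<subseteq> A" and tot: "\<And>f g. f \<in> C \<Longrightarrow> g \<in> C \<Longrightarrow> P f g \<or> P g f"
      by (auto simp: Chains_def relation_of_def)
    show "\<exists>u\<in>A. \<forall>a\<in>C. P a u"
    proof (cases "C = {}")
      case True
      have "restrict p (carrier M) \<in> A" using p by (simp add: A_def sub_restrict)
      with True show ?thesis by auto
    next
      case False
      define u where "u x = (INF f\<in>C. f x)" for x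
      have le: "u x \<le> f x" if "f \<in> C" "x \<in> carrier M" for f x
        unfolding u_def using that low CA
        by (auto intro!: cINF_lower bdd_belowI2[where m = "- p (\<ominus> x)"])
      have ge: "m \<le> u x" if "\<And>f. f \<in> C \<Longrightarrow> m \<le> f x" for m x
        unfolding u_def using that False by (auto intro!: cINF_greatest)
      have "sublinear_on M u"
      proof (rule sublinear_onI)
        fix a b assume ab: "a \<in> carrier M" "b \<in> carrier M"
        have 1: "u (a \<oplus> b) \<le> f a + g b" if fg: "f \<in> C" "g \<in> C" for f g
        proof -
          \<comment> \<open>The chain is totally ordered, so the smaller of \<open>f\<close> and
            \<open>g\<close> serves in both places and subadditivity of one member gives the mixed
            bound.\<close>
          obtain h where h: "h \<in> C" "h a \<le> f a" "h b \<le> g b"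
            using tot[OF fg] fg ab unfolding P_def by auto
          have "u (a \<oplus> b) \<le> h (a \<oplus> b)" using le[OF h(1)] ab by simp
          also have "\<dots> \<le> h a + h b"
            using h(1) CA ab by (auto simp: A_def sublinear_on_def)
          finally show ?thesis using h by simp
        qed
        have "u (a \<oplus> b) - f a \<le> u b" if "f \<in> C" for f
          using 1[OF that] by (intro ge) (simp add: algebra_simps)
        then have "u (a \<oplus> b) - u b \<le> u a"
          by (intro ge) (simp add: algebra_simps)
        then show "u (a \<oplus> b) \<le> u a + u b" by simp
      next
        fix t :: real and a assume t: "t > 0" and a: "a \<in> carrier M"
        have "u (complex_of_real t \<odot> a) / t \<le> f a" if "f \<in> C" for f
        proof -
          have "u (complex_of_real t \<odot> a) \<le> f (complex_of_real t \<odot> a)"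
            using le[OF that] a by (simp add: smult_in)
          also have "\<dots> = t * f a"
            using that CA a t by (auto simp: A_def sublinear_on_def)
          finally show ?thesis using t by (simp add: field_simps)
        qed
        then have "u (complex_of_real t \<odot> a) / t \<le> u a" by (rule ge)
        then show "u (complex_of_real t \<odot> a) \<le> t * u a"
          using t by (simp add: field_simps)
      qed
      moreover have "u x \<le> p x" if x: "x \<in> carrier M" for x
      proof -
        obtain f where "f \<in> C" using False by blast
        then have "u x \<le> f x" "f x \<le> p x" using le x CA by (auto simp: A_def)
        then show ?thesis by simp
      qed
      ultimately have "restrict u (carrier M) \<in> A"
        by (simp add: A_def sub_restrict)
      moreover have "\<forall>a\<in>C. P a (restrict u (carrier M))"
        using le by (simp add: P_def)
      ultimately show ?thesis by blast
    qed
  qed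
  then obtain q where q: "q \<in> A" and min: "\<And>a. a \<in> A \<Longrightarrow> P q a \<Longrightarrow> a = q" by blast
  show ?thesis
  proof (rule that[of q])
    fix q' x assume q': "sublinear_on M q'" "\<And>x. x \<in> carrier M \<Longrightarrow> q' x \<le> q x"
      and x: "x \<in> carrier M"
    have "restrict q' (carrier M) \<in> A"
      using q' q by (force simp: A_def sub_restrict)
    then have "restrict q' (carrier M) = q"
      by (rule min) (use q' in \<open>simp add: P_def\<close>)
    then show "q' x = q x" using x by auto
  qed (use q in \<open>auto simp: A_def\<close>)
qed

text \<open>The minimal functional is taken below \<open>tilt M p e\<close> rather than
  \<open>p\<close>: at \<open>\<ominus> e\<close> the tilt is at most
  \<open>p \<zero> - p e\<close>, and this forces the value \<open>p e\<close> at
  \<open>e\<close>.\<close>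

lemma Hahn_Banach_real:
  assumes p: "sublinear_on M p" and e: "e \<in> carrier M"
  obtains f :: "'v \<Rightarrow> real" where
    "\<And>a b. a \<in> carrier M \<Longrightarrow> b \<in> carrier M \<Longrightarrow> f (a \<oplus> b) = f a + f b"
    "\<And>r a. a \<in> carrier M \<Longrightarrow> f (complex_of_real r \<odot> a) = r * f a"
    "\<And>a. a \<in> carrier M \<Longrightarrow> f a \<le> p a"
    "f e = p e"
proof -
  obtain q where q: "sublinear_on M q" "\<And>x. x \<in> carrier M \<Longrightarrow> q x \<le> tilt M p e x"
    and min: "\<And>q' x. sublinear_on M q' \<Longrightarrow> (\<And>x. x \<in> carrier M \<Longrightarrow> q' x \<le> q x) \<Longrightarrow>
       x \<in> carrier M \<Longrightarrow> q' x = q x"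
    using minimal_sublinear_exists[OF sublinear_on_tilt[OF p e]] by blast
  have add: "q (a \<oplus> b) = q a + q b" if ab: "a \<in> carrier M" "b \<in> carrier M" for a b
  proof -
    \<comment> \<open>A tilt of \<open>q\<close> is sublinear and lies below \<open>q\<close>, so
      minimality makes the two equal; \<open>tilt_le_diff\<close> then reads as
      superadditivity.\<close>
    have "tilt M q b a = q a"
      using min[OF sublinear_on_tilt[OF q(1) ab(2)] tilt_le[OF q(1) ab(2)] ab(1)] by simp
    then have "q a + q b \<le> q (a \<oplus> b)"
      using tilt_le_diff[OF q(1) ab(2,1)] by simp
    moreover have "q (a \<oplus> b) \<le> q a + q b"
      using q(1) ab by (simp add: sublinear_on_def)
    ultimately show ?thesis by simp
  qed
  have neg: "q (\<ominus> a) = - q a" if "a \<in> carrier M" for a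
    using add[of a "\<ominus> a"] that sublinear_on_zero[OF q(1)] by (simp add: M.r_neg)
  have pos: "q (complex_of_real t \<odot> a) = t * q a" if "t > 0" "a \<in> carrier M" for t a
    using q(1) that by (simp add: sublinear_on_def)
  have hom: "q (complex_of_real r \<odot> a) = r * q a" if a: "a \<in> carrier M" for r a
  proof (cases "r = 0")
    case True
    then show ?thesis using a sublinear_on_zero[OF q(1)] by (simp add: smult_0)
  next
    case False
    show ?thesis
    proof (cases "r > 0")
      case False
      have "complex_of_real r \<odot> a = \<ominus> (complex_of_real (- r) \<odot> a)"
        using a by (simp add: smult_minus1[symmetric] vs_simps)
      then show ?thesis
        using False \<open>r \<noteq> 0\<close> a neg[of "complex_of_real (- r) \<odot> a"] pos[of "- r" a]
        by (simp add: smult_in)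
    qed (use pos a in simp)
  qed
  have le: "q a \<le> p a" if "a \<in> carrier M" for a
    using q(2)[OF that] tilt_le[OF p e that] by simp
  have "q (\<ominus> e) \<le> - p e"
    using q(2)[of "\<ominus> e"] tilt_le_diff[OF p e, of "\<ominus> e"] e sublinear_on_zero[OF p]
    by (simp add: M.l_neg)
  then have "q e = p e" using neg[OF e] le[OF e] by simp
  then show ?thesis using that[of q] add hom le by blast
qed

text \<open>The real functional \<open>f\<close> becomes the real part of \<open>\<psi>\<close>;
  complex linearity forces the imaginary part to be \<open>- f (\<i> \<odot> a)\<close>. A rotation
  reduces the bound on the modulus to that on the real part.\<close>

lemma Hahn_Banach:
  assumes p: "seminorm_on M p" and e: "e \<in> carrier M"
  obtains \<psi> :: "'v \<Rightarrow> complex" where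
    "\<And>a b. a \<in> carrier M \<Longrightarrow> b \<in> carrier M \<Longrightarrow> \<psi> (a \<oplus> b) = \<psi> a + \<psi> b"
    "\<And>c a. a \<in> carrier M \<Longrightarrow> \<psi> (c \<odot> a) = c * \<psi> a"
    "\<And>a. a \<in> carrier M \<Longrightarrow> cmod (\<psi> a) \<le> p a"
    "\<psi> e = of_real (p e)"
proof -
  have "sublinear_on M p"
    using p by (auto simp: sublinear_on_def seminorm_on_def)
  then obtain f where add: "\<And>a b. a \<in> carrier M \<Longrightarrow> b \<in> carrier M \<Longrightarrow> f (a \<oplus> b) = f a + f b"
    and hom: "\<And>r a. a \<in> carrier M \<Longrightarrow> f (complex_of_real r \<odot> a) = r * f a"
    and le: "\<And>a. a \<in> carrier M \<Longrightarrow> f a \<le> p a"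
    and fe: "f e = p e"
    using e Hahn_Banach_real by blast
  define \<psi> where "\<psi> a = Complex (f a) (- f (\<i> \<odot> a))" for a
  have fc: "f (c \<odot> a) = Re c * f a + Im c * f (\<i> \<odot> a)" if a: "a \<in> carrier M" for c a
  proof -
    have "c \<odot> a = complex_of_real (Re c) \<odot> a \<oplus> complex_of_real (Im c) \<odot> (\<i> \<odot> a)"
      using a smult_add_left[OF a, of "complex_of_real (Re c)" "complex_of_real (Im c) * \<i>"]
      by (simp add: smult_smult complex_eq mult.commute flip: complex_eq)
    then show ?thesis using a by (simp add: add hom smult_in)
  qed
  have \<psi>c: "\<psi> (c \<odot> a) = c * \<psi> a" if a: "a \<in> carrier M" for c a
    using a fc[OF a, of c] fc[OF a, of "\<i> * c"]
    by (simp add: \<psi>_def complex_eq_iff smult_smult algebra_simps)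
  have bound: "cmod (\<psi> a) \<le> p a" if a: "a \<in> carrier M" for a
  proof -
    \<comment> \<open>This scalar rotates \<open>\<psi> a\<close> onto its modulus. Since
      \<open>sgn 0 = 0\<close>, its own modulus is 1 or 0, so the chain ends with an
      inequality.\<close>
    let ?c = "cnj (sgn (\<psi> a))"
    have "?c * \<psi> a = of_real (cmod (\<psi> a))"
      by (cases "\<psi> a = 0")
        (simp_all add: sgn_eq complex_norm_square[symmetric] mult.commute[of "cnj (\<psi> a)"]
          power2_eq_square)
    then have "cmod (\<psi> a) = Re (\<psi> (?c \<odot> a))"
      using \<psi>c[OF a, of ?c] by simp
    also have "\<dots> = f (?c \<odot> a)" by (simp add: \<psi>_def)
    also have "\<dots> \<le> p (?c \<odot> a)" using le a by (simp add: smult_in)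
    also have "\<dots> = cmod ?c * p a" using p a by (simp add: seminorm_on_def)
    also have "\<dots> \<le> p a" using p a by (simp add: seminorm_on_def norm_sgn)
    finally show ?thesis .
  qed
  have "\<psi> e = of_real (p e)"
  proof -
    have "Re (\<psi> e) = p e" by (simp add: \<psi>_def fe)
    \<comment> \<open>The modulus of \<open>\<psi> e\<close> is at most its real part
      \<open>p e\<close>, which leaves no room for an imaginary part.\<close>
    moreover have "(Im (\<psi> e))\<^sup>2 \<le> 0"
      using bound[OF e] \<open>Re (\<psi> e) = p e\<close> power_mono[OF bound[OF e], of 2]
      by (simp add: cmod_power2)
    ultimately show ?thesis by (simp add: complex_eq_iff)
  qed
  moreover have "\<psi> (a \<oplus> b) = \<psi> a + \<psi> b" if "a \<in> carrier M" "b \<in> carrier M" for a b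
    using that by (simp add: \<psi>_def add smult_add_right smult_in complex_eq_iff)
  ultimately show ?thesis using that[of \<psi>] \<psi>c bound by blast
qed

end

section \<open>Linear forms and seminorm topologies\<close>

definition linear_form :: "'v cvs \<Rightarrow> ('v \<Rightarrow> complex) \<Rightarrow> bool" where
  "linear_form M \<phi> \<longleftrightarrow>
     (\<forall>a\<in>carrier M. \<forall>b\<in>carrier M. \<phi> (a \<oplus>\<^bsub>M\<^esub> b) = \<phi> a + \<phi> b) \<and>
     (\<forall>c. \<forall>a\<in>carrier M. \<phi> (c \<odot>\<^bsub>M\<^esub> a) = c * \<phi> a)"

lemma top_dual_iff:
  "\<phi> \<in> top_dual M T \<longleftrightarrow>
     \<phi> \<in> extensional (carrier M) \<and> linear_form M \<phi> \<and> continuous_map T euclidean \<phi>"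
  by (auto simp: top_dual_def linear_form_def)

lemma linear_subspace_subset: "linear_subspace W M \<Longrightarrow> W \<subseteq> carrier M"
  using subgroup.subset[OF submodule.axioms(1)] by fastforce

lemma linear_subspace_add:
  "linear_subspace W M \<Longrightarrow> a \<in> W \<Longrightarrow> b \<in> W \<Longrightarrow> a \<oplus>\<^bsub>M\<^esub> b \<in> W"
  using subgroup.m_closed[OF submodule.axioms(1)] by fastforce

lemma linear_subspace_smult:
  "linear_subspace W M \<Longrightarrow> a \<in> W \<Longrightarrow> c \<odot>\<^bsub>M\<^esub> a \<in> W"
  using submodule.smult_closed[of W CC M c a] by (simp add: ring_of_type_algebra_def)

lemma linear_subspace_zero: "linear_subspace W M \<Longrightarrow> \<zero>\<^bsub>M\<^esub> \<in> W"
  using subgroup.one_closed[OF submodule.axioms(1)] by fastforce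

lemma topspace_seminorm_topology: "topspace (seminorm_topology M P) = carrier M"
  by (auto simp: seminorm_topology_def)

context complex_vs
begin

lemma linear_form_zero: "linear_form M \<phi> \<Longrightarrow> \<phi> \<zero> = 0"
  unfolding linear_form_def by (metis M.zero_closed mult_zero_left smult_0)

lemma linear_form_minus:
  assumes "linear_form M \<phi>" "a \<in> carrier M" "b \<in> carrier M"
  shows "\<phi> (a \<ominus> b) = \<phi> a - \<phi> b"
proof -
  have "\<phi> (a \<ominus> b) = \<phi> a + \<phi> ((-1) \<odot> b)"
    using assms by (simp add: a_minus_def smult_minus1 linear_form_def)
  then show ?thesis using assms unfolding linear_form_def by simp
qed

text \<open>The preimage of a ball of radius \<open>\<epsilon>\<close> around
  \<open>\<phi> a\<close> contains the generating set of \<open>p\<close> with centre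
  \<open>a\<close> and radius \<open>\<epsilon>\<close>, and \<open>p \<zero> = 0\<close> puts
  \<open>a\<close> into that set.\<close>

lemma continuous_map_linear_form:
  assumes \<phi>: "linear_form M \<phi>" and p: "p \<in> P" "p \<zero> = 0"
    and le: "\<And>a. a \<in> carrier M \<Longrightarrow> cmod (\<phi> a) \<le> p a"
  shows "continuous_map (seminorm_topology M P) euclidean \<phi>"
  unfolding continuous_map_def topspace_seminorm_topology
proof (intro conjI allI impI)
  fix U :: "complex set" assume U: "openin euclidean U"
  show "openin (seminorm_topology M P) {a \<in> carrier M. \<phi> a \<in> U}"
  proof (subst openin_subopen, intro ballI)
    fix a assume "a \<in> {a \<in> carrier M. \<phi> a \<in> U}"
    then have a: "a \<in> carrier M" "\<phi> a \<in> U" by auto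
    then obtain \<epsilon> where \<epsilon>: "\<epsilon> > 0" "ball (\<phi> a) \<epsilon> \<subseteq> U"
      using U openE by (metis open_openin)
    let ?W = "{b \<in> carrier M. p (b \<ominus> a) < \<epsilon>}"
    have "openin (seminorm_topology M P) ?W"
      unfolding seminorm_topology_def
      by (rule topology_generated_by_Basis) (use p(1) a(1) \<epsilon>(1) in blast)
    moreover have "a \<in> ?W" using a p(2) \<epsilon> by (simp add: a_minus_def M.r_neg)
    moreover have "?W \<subseteq> {a \<in> carrier M. \<phi> a \<in> U}"
    proof
      fix b assume b: "b \<in> ?W"
      then have "cmod (\<phi> b - \<phi> a) < \<epsilon>"
        using le[of "b \<ominus> a"] linear_form_minus[OF \<phi>, of b a] a by auto
      then have "\<phi> b \<in> ball (\<phi> a) \<epsilon>" by (simp add: dist_norm norm_minus_commute)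
      then show "b \<in> {a \<in> carrier M. \<phi> a \<in> U}" using b \<epsilon>(2) by auto
    qed
    ultimately show "\<exists>T. openin (seminorm_topology M P) T \<and> a \<in> T \<and>
        T \<subseteq> {a \<in> carrier M. \<phi> a \<in> U}" by blast
  qed
qed auto

text \<open>If every \<open>p\<close> vanished at \<open>a\<close>, then \<open>a\<close> and
  \<open>\<zero>\<close> would lie in the same generating sets, hence in the same open sets, against
  the Hausdorff property.\<close>

lemma seminorms_separate:
  assumes P: "\<And>p. p \<in> P \<Longrightarrow> seminorm_on M p"
    and H: "Hausdorff_space (seminorm_topology M P)"
    and a: "a \<in> carrier M" "a \<noteq> \<zero>"
  obtains p where "p \<in> P" "p a \<noteq> 0"
proof -
  have "\<exists>p\<in>P. p a \<noteq> 0"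
  proof (rule ccontr)
    assume "\<not> (\<exists>p\<in>P. p a \<noteq> 0)"
    then have 0: "p a = 0" if "p \<in> P" for p using that by blast
    have shift: "p (a \<ominus> c) = p (\<zero> \<ominus> c)" if p: "p \<in> P" and c: "c \<in> carrier M" for p c
    proof -
      have sub: "p (x \<oplus> y) \<le> p x + p y" if "x \<in> carrier M" "y \<in> carrier M" for x y
        using P[OF p] that by (simp add: seminorm_on_def)
      have "p ((-1) \<odot> a) = 0"
        using P[OF p] a(1) 0[OF p] unfolding seminorm_on_def by simp
      then have "p (\<ominus> a) = 0" using a by (simp add: smult_minus1)
      moreover have "\<ominus> a \<oplus> (a \<oplus> \<ominus> c) = \<ominus> c"
        using a c by (simp add: M.r_neg1)
      ultimately show ?thesis
        using sub[of a "\<ominus> c"] sub[of "\<ominus> a" "a \<oplus> \<ominus> c"] a c 0[OF p]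
        by (simp add: a_minus_def)
    qed
    have "a \<in> U \<longleftrightarrow> \<zero> \<in> U" if "openin (seminorm_topology M P) U" for U
      using openin_topology_generated_by[OF that[unfolded seminorm_topology_def]]
    proof (induction rule: generate_topology_on.induct)
      case (Basis s)
      then show ?case using a(1) by (auto; metis shift)
    qed auto
    then show False
      using H a unfolding Hausdorff_space_def topspace_seminorm_topology disjnt_def
      by (metis M.zero_closed disjoint_iff)
  qed
  then show ?thesis using that by blast
qed

section \<open>Finest locally convex topologies and their continuous linear forms\<close>

text \<open>Makes this initial topology a competitor in \<open>is_finest_lc_topology\<close>.
  Composed with \<open>\<phi>\<close>, the operations become those of the complex numbers, and
  preimages of balls are convex.\<close>

lemma locally_convex_pullback:
  assumes \<phi>: "linear_form M \<phi>"
  shows "locally_convex M (pullback_topology (carrier M) \<phi> euclidean)"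
proof -
  let ?T = "pullback_topology (carrier M) \<phi> euclidean"
  have ts: "topspace ?T = carrier M" by (simp add: topspace_pullback_topology)
  have c: "continuous_map ?T euclidean \<phi>"
    using continuous_map_pullback[of euclidean euclidean "\<lambda>z. z" "carrier M" \<phi>]
    by (simp add: comp_def)
  have "continuous_map (prod_topology ?T ?T) euclidean (\<lambda>z. \<phi> (fst z) + \<phi> (snd z))"
    by (intro continuous_map_add continuous_map_compose[OF continuous_map_fst c, unfolded comp_def]
        continuous_map_compose[OF continuous_map_snd c, unfolded comp_def])
  then have "continuous_map (prod_topology ?T ?T) euclidean (\<phi> \<circ> (\<lambda>(a, b). a \<oplus> b))"
    by (rule continuous_map_eq) (use \<phi> ts in \<open>auto simp: linear_form_def\<close>)
  then have add: "continuous_map (prod_topology ?T ?T) ?T (\<lambda>(a, b). a \<oplus> b)"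
    by (rule continuous_map_pullback') (auto simp: ts)
  have "continuous_map (prod_topology euclidean ?T) euclidean (\<lambda>z. fst z * \<phi> (snd z))"
    using continuous_map_fst[of "euclidean :: complex topology" ?T]
      continuous_map_compose[OF continuous_map_snd[of "euclidean :: complex topology" ?T] c]
    unfolding continuous_map_atin limitin_canonical_iff comp_def
    by (intro ballI tendsto_mult) auto
  then have "continuous_map (prod_topology euclidean ?T) euclidean (\<phi> \<circ> (\<lambda>(c, a). c \<odot> a))"
    by (rule continuous_map_eq) (use \<phi> ts in \<open>auto simp: linear_form_def\<close>)
  then have smult: "continuous_map (prod_topology euclidean ?T) ?T (\<lambda>(c, a). c \<odot> a)"
    by (rule continuous_map_pullback') (auto simp: ts smult_in)
  have "neighbourhood_base_at \<zero> (convex_in M) ?T"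
    unfolding neighbourhood_base_at_def
  proof (intro allI impI, elim conjE)
    fix W assume "openin ?T W" "\<zero> \<in> W"
    then obtain U where U: "open U" "W = \<phi> -` U \<inter> carrier M"
      by (auto simp: openin_pullback_topology)
    then have "0 \<in> U" using \<open>\<zero> \<in> W\<close> linear_form_zero[OF \<phi>] by auto
    then obtain \<epsilon> where \<epsilon>: "\<epsilon> > 0" "ball 0 \<epsilon> \<subseteq> U" using U(1) openE by metis
    let ?V = "\<phi> -` ball 0 \<epsilon> \<inter> carrier M"
    have "convex_in M ?V"
      unfolding convex_in_def
    proof (intro conjI ballI allI impI)
      fix a b and t :: real assume ab: "a \<in> ?V" "b \<in> ?V" and t: "0 \<le> t \<and> t \<le> 1"
      have "(1 - t) *\<^sub>R \<phi> a + t *\<^sub>R \<phi> b \<in> ball 0 \<epsilon>"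
        using ab t convex_ball[of "0 :: complex" \<epsilon>] unfolding convex_alt by auto
      then show "complex_of_real (1 - t) \<odot> a \<oplus> complex_of_real t \<odot> b \<in> ?V"
        using ab \<phi> by (auto simp: linear_form_def smult_in scaleR_conv_of_real simp del: of_real_diff)
    qed auto
    moreover have "openin ?T ?V"
      unfolding openin_pullback_topology by (rule exI[of _ "ball 0 \<epsilon>"]) simp
    ultimately show "\<exists>U V. openin ?T U \<and> convex_in M V \<and> \<zero> \<in> U \<and> U \<subseteq> V \<and> V \<subseteq> W"
      using \<epsilon> U(2) linear_form_zero[OF \<phi>]
      by (intro exI[of _ ?V]) auto
  qed
  then show ?thesis
    using ts add smult module_axioms by (simp add: locally_convex_def topological_vs_def)
qed

text \<open>Each \<open>h i\<close> is continuous into the initial topology of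
  \<open>\<phi>\<close>, so the finest topology refines that one and makes \<open>\<phi>\<close>
  continuous.\<close>

lemma top_dual_finest_lc_topology:
  assumes h: "\<And>i. i \<in> I \<Longrightarrow> h i \<in> topspace (S i) \<rightarrow> carrier M"
    and \<phi>: "\<phi> \<in> extensional (carrier M)" "linear_form M \<phi>"
    and cont: "\<And>i. i \<in> I \<Longrightarrow> continuous_map (S i) euclidean (\<lambda>f. \<phi> (h i f))"
  shows "\<phi> \<in> top_dual M (finest_lc_topology M I S h)"
proof -
  let ?T = "finest_lc_topology M I S h" and ?P = "pullback_topology (carrier M) \<phi> euclidean"
  have T: "is_finest_lc_topology M I S h ?T"
    using finest_lc_topology[OF module_axioms h] .
  have "continuous_map (S i) ?P (h i)" if "i \<in> I" for i
    using cont[OF that] h[OF that] by (intro continuous_map_pullback') (auto simp: comp_def)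
  then have fine: "openin ?T U" if "openin ?P U" for U
    using T locally_convex_pullback[OF \<phi>(2)] that unfolding is_finest_lc_topology_def by blast
  have "topspace ?T = carrier M"
    using T by (simp add: is_finest_lc_topology_def locally_convex_def topological_vs_def)
  then have "continuous_map ?T euclidean \<phi>"
    unfolding continuous_map_def using fine
    by (auto simp: openin_pullback_topology vimage_def Int_def conj_commute)
  then show ?thesis using \<phi> by (simp add: top_dual_iff)
qed

end

section \<open>Operator spaces and the stalks of a bundle\<close>

lemma linear_subspace_continuous_endos:
  assumes "topological_vs M T"
  shows "linear_subspace (continuous_endos M T) (prod_space (carrier M) (\<lambda>_. M))"
proof -
  interpret complex_vs M
    using assms by (simp add: topological_vs_def vector_space_on_iff)
  interpret P: complex_vs "prod_space (carrier M) (\<lambda>_. M)"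
    using vector_space_on_prod_space[of "carrier M" "\<lambda>_. M"] module_axioms
    by (simp add: vector_space_on_iff)
  have ts: "topspace T = carrier M"
    and add: "continuous_map (prod_topology T T) T (\<lambda>(a, b). a \<oplus>\<^bsub>M\<^esub> b)"
    and sm: "continuous_map (prod_topology euclidean T) T (\<lambda>(c, a). c \<odot>\<^bsub>M\<^esub> a)"
    using assms by (auto simp: topological_vs_def)
  show ?thesis
  proof (rule P.linear_subspaceI)
    show "continuous_endos M T \<subseteq> carrier (prod_space (carrier M) (\<lambda>_. M))"
      by (auto simp: continuous_endos_def endomorphisms_def prod_space_def)
    have "restrict (\<lambda>a. a) (carrier M) \<in> continuous_endos M T"
      by (auto simp: continuous_endos_def endomorphisms_def smult_in ts
          intro!: continuous_map_eq[OF continuous_map_id])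
    then show "continuous_endos M T \<noteq> {}" by blast
  next
    fix f g assume f: "f \<in> continuous_endos M T" and g: "g \<in> continuous_endos M T"
    then have cl: "f a \<in> carrier M" "g a \<in> carrier M" if "a \<in> carrier M" for a
      using that by (auto simp: continuous_endos_def endomorphisms_def)
    have "continuous_map T (prod_topology T T) (\<lambda>a. (f a, g a))"
      using f g by (auto simp: continuous_endos_def intro: continuous_map_pairedI)
    from continuous_map_compose[OF this add]
    have "continuous_map T T (f \<oplus>\<^bsub>prod_space (carrier M) (\<lambda>_. M)\<^esub> g)"
      by (rule continuous_map_eq) (auto simp: ts prod_space_def)
    then show "f \<oplus>\<^bsub>prod_space (carrier M) (\<lambda>_. M)\<^esub> g \<in> continuous_endos M T"
      using f g cl
      by (auto simp: continuous_endos_def endomorphisms_def prod_space_def smult_in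
          smult_add_right M.add.m_ac)
  next
    fix c :: complex and f assume f: "f \<in> continuous_endos M T"
    then have cl: "f a \<in> carrier M" if "a \<in> carrier M" for a
      using that by (auto simp: continuous_endos_def endomorphisms_def)
    have "continuous_map T (prod_topology euclidean T) (\<lambda>a. (c, f a))"
      using f by (auto simp: continuous_endos_def intro: continuous_map_pairedI)
    from continuous_map_compose[OF this sm]
    have "continuous_map T T (c \<odot>\<^bsub>prod_space (carrier M) (\<lambda>_. M)\<^esub> f)"
      by (rule continuous_map_eq) (auto simp: ts prod_space_def)
    then show "c \<odot>\<^bsub>prod_space (carrier M) (\<lambda>_. M)\<^esub> f \<in> continuous_endos M T"
      using f cl
      by (auto simp: continuous_endos_def endomorphisms_def prod_space_def smult_in
          smult_add_right smult_smult mult.commute)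
  qed
qed

lemma vector_space_on_endo_space:
  assumes "topological_vs M T"
  shows "vector_space_on (endo_space M T)"
  unfolding endo_space_def
  using assms linear_subspace_continuous_endos[OF assms]
  by (intro vector_space_on_subspace vector_space_on_prod_space) (auto simp: topological_vs_def)

text \<open>The addition of the bundle is continuous on pairs from a common stalk. Restricted to one
  stalk it takes values there, so the subspace topology inherits its continuity; scalar
  multiplication likewise.\<close>

lemma topological_vs_stalk:
  assumes V: "bundle_of_Omega_spaces V" and x: "x \<in> topspace (base_top V)"
  shows "topological_vs (stalk V x) (stalk_top V x)"
proof -
  let ?C = "carrier (stalk V x)" and ?E = "total_top V"
  have vs: "vector_space_on (stalk V x)" using V x by (simp add: bundle_of_Omega_spaces_def)
  interpret complex_vs "stalk V x" using vs by (simp add: vector_space_on_iff)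
  have ts: "topspace (stalk_top V x) = ?C" by (auto simp: stalk_top_def stalk_def)
  have "continuous_map (subtopology (prod_topology ?E ?E) (?C \<times> ?C)) ?E (\<lambda>(a, b). fib_add V a b)"
    by (rule continuous_map_from_subtopology_mono[where
          T = "{(a, b). proj V a = proj V b}"])
      (use V in \<open>auto simp: bundle_of_Omega_spaces_def stalk_def\<close>)
  moreover have "fib_add V a b \<in> ?C" if "a \<in> ?C" "b \<in> ?C" for a b
    using M.a_closed[OF that] by (simp add: stalk_def)
  ultimately have add: "continuous_map (prod_topology (stalk_top V x) (stalk_top V x)) (stalk_top V x)
      (\<lambda>(a, b). a \<oplus>\<^bsub>stalk V x\<^esub> b)"
    unfolding stalk_top_def continuous_map_in_subtopology
    by (auto simp: stalk_def simp flip: subtopology_Times)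
  have "continuous_map (prod_topology euclidean (subtopology ?E ?C)) ?E (\<lambda>(c, a). fib_smult V c a)"
    using V unfolding prod_topology_subtopology
    by (auto intro: continuous_map_from_subtopology simp: bundle_of_Omega_spaces_def)
  moreover have "fib_smult V c a \<in> ?C" if "a \<in> ?C" for c a
    using smult_in[OF that, of c] by (simp add: stalk_def)
  ultimately have "continuous_map (prod_topology euclidean (stalk_top V x)) (stalk_top V x)
      (\<lambda>(c, a). c \<odot>\<^bsub>stalk V x\<^esub> a)"
    unfolding stalk_top_def continuous_map_in_subtopology
    by (auto simp: stalk_def)
  with vs ts add show ?thesis by (simp add: topological_vs_def)
qed

text \<open>The set where \<open>f\<close> and \<open>g\<close> agree is a linear subspace, and it
  is closed because the target is Hausdorff; so it contains the closed span of
  \<open>S\<close>.\<close>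

lemma linear_eq_on_total:
  assumes "topological_vs M T" "Hausdorff_space T" "total_in M T S"
    and f: "f \<in> continuous_endos M T" and g: "g \<in> continuous_endos M T"
    and eq: "\<And>b. b \<in> S \<Longrightarrow> f b = g b"
  shows "f = g"
proof -
  interpret complex_vs M
    using assms by (simp add: topological_vs_def vector_space_on_iff)
  have ts: "topspace T = carrier M" using assms(1) by (simp add: topological_vs_def)
  let ?W = "{a \<in> carrier M. f a = g a}"
  have z: "k \<zero>\<^bsub>M\<^esub> = \<zero>\<^bsub>M\<^esub>" if "k \<in> continuous_endos M T" for k
  proof -
    have "k (0 \<odot>\<^bsub>M\<^esub> \<zero>\<^bsub>M\<^esub>) = 0 \<odot>\<^bsub>M\<^esub> k \<zero>\<^bsub>M\<^esub>" "k \<zero>\<^bsub>M\<^esub> \<in> carrier M"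
      using that by (auto simp: continuous_endos_def endomorphisms_def)
    then show ?thesis by (simp add: smult_0)
  qed
  have "linear_subspace ?W M"
  proof (rule linear_subspaceI)
    show "?W \<noteq> {}" using z[OF f] z[OF g] by force
  qed (use f g in \<open>auto simp: continuous_endos_def endomorphisms_def smult_in\<close>)
  moreover have "S \<subseteq> ?W" using assms(3) eq by (auto simp: total_in_def)
  ultimately have "linear_span M S \<subseteq> ?W" by (auto simp: linear_span_def)
  moreover have "closedin T ?W"
    using closedin_continuous_maps_eq[OF assms(2), of T f g] f g
    by (simp add: continuous_endos_def ts)
  ultimately have "carrier M \<subseteq> ?W"
    using assms(3) closure_of_minimal unfolding total_in_def by metis
  moreover have "f \<in> extensional (carrier M)" "g \<in> extensional (carrier M)"
    using f g by (auto simp: continuous_endos_def endomorphisms_def PiE_def)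
  ultimately show ?thesis by (intro extensionalityI[of f "carrier M" g]) auto
qed

section \<open>Uniqueness of weak integrals and separation of the operators of a stalk\<close>

lemma weak_integral_eqI:
  assumes "is_weak_integral M T \<mu> f z"
    and "\<And>z'. z' \<in> carrier M \<Longrightarrow> (\<And>\<phi>. \<phi> \<in> top_dual M T \<Longrightarrow> \<phi> z' = \<phi> z) \<Longrightarrow> z' = z"
  shows "weak_integral M T \<mu> f = z"
  unfolding weak_integral_def
proof (rule the_equality)
  \<comment> \<open>Two weak integrals of one function have the same value under every continuous
    linear form.\<close>
  show "z' = z" if "is_weak_integral M T \<mu> f z'" for z'
    using that assms(1) unfolding is_weak_integral_def by (metis assms(2))
qed fact

lemma Lx_simps:
  "carrier (Lx V x) = continuous_endos (stalk V x) (stalk_top V x)"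
  "f \<oplus>\<^bsub>Lx V x\<^esub> g = (\<lambda>e\<in>carrier (stalk V x). f e \<oplus>\<^bsub>stalk V x\<^esub> g e)"
  "c \<odot>\<^bsub>Lx V x\<^esub> f = (\<lambda>e\<in>carrier (stalk V x). c \<odot>\<^bsub>stalk V x\<^esub> f e)"
  "\<zero>\<^bsub>Lx V x\<^esub> = (\<lambda>e\<in>carrier (stalk V x). \<zero>\<^bsub>stalk V x\<^esub>)"
  by (simp_all add: Lx_def endo_space_def prod_space_def)

text \<open>Needed because the supremum in \<open>sup0\<close> dominates its members only over a set
  bounded above. The open neighbourhood of zero where \<open>\<nu> (f a) < 1\<close> absorbs
  \<open>B\<close>.\<close>

lemma bdd_above_image_bounded_set:
  assumes tvs: "topological_vs M T" and f: "f \<in> continuous_endos M T" and \<nu>: "seminorm_on M \<nu>"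
    and ball: "openin T {e \<in> carrier M. \<nu> e < 1}"
    and B: "B \<in> bounded_sets M T"
  shows "bdd_above ((\<lambda>b. \<nu> (f b)) ` B)"
proof -
  interpret complex_vs M
    using tvs by (simp add: topological_vs_def vector_space_on_iff)
  have ts: "topspace T = carrier M" using tvs by (simp add: topological_vs_def)
  have fc: "f a \<in> carrier M" "f (c \<odot>\<^bsub>M\<^esub> a) = c \<odot>\<^bsub>M\<^esub> f a" if "a \<in> carrier M" for a c
    using f that by (auto simp: continuous_endos_def endomorphisms_def)
  have hom: "\<nu> (c \<odot>\<^bsub>M\<^esub> a) = cmod c * \<nu> a" if "a \<in> carrier M" for a c
    using \<nu> that by (simp add: seminorm_on_def)
  let ?U = "{a \<in> carrier M. \<nu> (f a) < 1}"
  have "openin T {a \<in> topspace T. f a \<in> {e \<in> carrier M. \<nu> e < 1}}"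
    by (rule openin_continuous_map_preimage[OF _ ball]) (use f in \<open>simp add: continuous_endos_def\<close>)
  moreover have "{a \<in> topspace T. f a \<in> {e \<in> carrier M. \<nu> e < 1}} = ?U"
    using fc by (auto simp: ts)
  ultimately have "openin T ?U" by simp
  moreover have "\<zero>\<^bsub>M\<^esub> \<in> ?U"
  proof -
    have "f (0 \<odot>\<^bsub>M\<^esub> \<zero>\<^bsub>M\<^esub>) = 0 \<odot>\<^bsub>M\<^esub> f \<zero>\<^bsub>M\<^esub>" "\<nu> (0 \<odot>\<^bsub>M\<^esub> f \<zero>\<^bsub>M\<^esub>) = 0"
      using fc hom by simp_all
    then show ?thesis by (simp add: smult_zero)
  qed
  ultimately obtain r where r: "r > 0" "B \<subseteq> (\<lambda>a. complex_of_real r \<odot>\<^bsub>M\<^esub> a) ` ?U"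
    using B unfolding bounded_sets_def by blast
  have "\<nu> (f b) \<le> r" if b: "b \<in> B" for b
  proof -
    obtain a where a: "a \<in> carrier M" "\<nu> (f a) < 1" "b = complex_of_real r \<odot>\<^bsub>M\<^esub> a"
      using b r by auto
    then have "\<nu> (f b) = r * \<nu> (f a)"
      using fc hom r by simp
    then show ?thesis using a(2) r(1) by simp
  qed
  then show ?thesis by (rule bdd_aboveI2)
qed

text \<open>By \<open>linear_eq_on_total\<close> it is enough to compare \<open>f\<close> and
  \<open>g\<close> on the total set; at a point \<open>b\<close> where they differed, evaluation
  followed by a Hahn-Banach functional would tell them apart.\<close>

lemma Lx_separated:
  assumes S: "Theta_E_structure V \<E> \<Theta> Y \<MM> \<gamma>" and x: "x \<in> topspace (base_top V)"
    and f: "f \<in> carrier (Lx V x)" and g: "g \<in> carrier (Lx V x)"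
    and eq: "\<And>\<phi>. \<phi> \<in> top_dual (Lx V x) (LS_top V \<E> \<Theta> x) \<Longrightarrow> \<phi> f = \<phi> g"
  shows "f = g"
proof -
  let ?M = "stalk V x" and ?T = "stalk_top V x"
  have V: "bundle_of_Omega_spaces V"
    and \<Theta>: "\<Theta> \<subseteq> (\<Pi>\<^sub>E x\<in>topspace (base_top V). bounded_sets (stalk V x) (stalk_top V x))"
    and tot: "total_in ?M ?T (\<Union>B\<in>\<Theta>. B_set V \<E> B x)"
    using S x by (auto simp: Theta_E_structure_def)
  have tvs: "topological_vs ?M ?T" by (rule topological_vs_stalk[OF V x])
  have Ts: "?T = seminorm_topology ?M (seminorms V)" and H: "Hausdorff_space ?T"
    and sn: "\<And>\<nu>. \<nu> \<in> seminorms V \<Longrightarrow> seminorm_on ?M \<nu>"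
    using V x by (auto simp: bundle_of_Omega_spaces_def)
  interpret complex_vs ?M
    using tvs by (simp add: topological_vs_def vector_space_on_iff)
  interpret L: complex_vs "Lx V x"
    unfolding Lx_def using vector_space_on_endo_space[OF tvs] by (simp add: vector_space_on_iff)
  have app: "k b \<in> carrier ?M" if "k \<in> carrier (Lx V x)" "b \<in> carrier ?M" for k b
    using that by (auto simp: Lx_simps continuous_endos_def endomorphisms_def)
  show ?thesis
  proof (rule linear_eq_on_total[OF tvs H tot])
    fix b assume "b \<in> (\<Union>B\<in>\<Theta>. B_set V \<E> B x)"
    then obtain B where B: "B \<in> \<Theta>" "b \<in> B_set V \<E> B x" by blast
    have bc: "b \<in> carrier ?M" using B tot unfolding total_in_def by blast
    have Bb: "B x \<in> bounded_sets ?M ?T" using B(1) \<Theta> x by auto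
    have sub: "B_set V \<E> B x \<subseteq> B x" using x by (auto simp: B_set_def D_sections_def)
    show "f b = g b"
    proof (rule ccontr)
      assume ne: "f b \<noteq> g b"
      let ?d = "f b \<ominus>\<^bsub>?M\<^esub> g b"
      have d: "?d \<in> carrier ?M" "?d \<noteq> \<zero>\<^bsub>?M\<^esub>"
        using ne app[OF f bc] app[OF g bc] M.minus_equality[of "f b" "\<ominus>\<^bsub>?M\<^esub> g b"]
        by (auto simp: a_minus_def)
      obtain \<nu> where \<nu>: "\<nu> \<in> seminorms V" "\<nu> ?d \<noteq> 0"
        using seminorms_separate[OF sn H[unfolded Ts] d] by blast
      obtain \<psi> where add: "\<And>a b. a \<in> carrier ?M \<Longrightarrow> b \<in> carrier ?M \<Longrightarrow>
            \<psi> (a \<oplus>\<^bsub>?M\<^esub> b) = \<psi> a + \<psi> b"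
        and hom: "\<And>c a. a \<in> carrier ?M \<Longrightarrow> \<psi> (c \<odot>\<^bsub>?M\<^esub> a) = c * \<psi> a"
        and le: "\<And>a. a \<in> carrier ?M \<Longrightarrow> cmod (\<psi> a) \<le> \<nu> a"
        and \<psi>d: "\<psi> ?d = of_real (\<nu> ?d)"
        using Hahn_Banach[OF sn[OF \<nu>(1)] d(1)] by blast
      define \<phi> where "\<phi> = (\<lambda>k\<in>carrier (Lx V x). \<psi> (k b))"
      \<comment> \<open>A generating seminorm of \<open>LS_top\<close>, given by
        \<open>\<nu>\<close> and the \<open>B\<close> from which \<open>b\<close> was taken; it will
        dominate \<open>\<phi>\<close>.\<close>
      define p where "p = (\<lambda>f. sup0 ((\<lambda>b. \<nu> (f b)) ` B_set V \<E> B x))"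
      have lin: "linear_form (Lx V x) \<phi>"
        using app add hom bc L.M.a_closed L.smult_in
        unfolding linear_form_def \<phi>_def by (auto simp: Lx_simps)
      \<comment> \<open>A generating set centred at zero, which is the open unit ball of
        \<open>\<nu>\<close> once the subtraction of zero is removed.\<close>
      have "openin ?T {e \<in> carrier ?M. \<nu> (e \<ominus>\<^bsub>?M\<^esub> \<zero>\<^bsub>?M\<^esub>) < 1}"
        unfolding Ts seminorm_topology_def
        by (rule topology_generated_by_Basis) (use \<nu>(1) M.zero_closed zero_less_one in blast)
      moreover have "e \<ominus>\<^bsub>?M\<^esub> \<zero>\<^bsub>?M\<^esub> = e" if "e \<in> carrier ?M" for e
        unfolding a_minus_def by (metis M.add.inv_equality M.l_zero M.r_zero M.zero_closed a_inv_def that)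
      then have "{e \<in> carrier ?M. \<nu> (e \<ominus>\<^bsub>?M\<^esub> \<zero>\<^bsub>?M\<^esub>) < 1} = {e \<in> carrier ?M. \<nu> e < 1}"
        by (intro Collect_cong conj_cong) auto
      ultimately have ball: "openin ?T {e \<in> carrier ?M. \<nu> e < 1}" by simp
      have "cmod (\<phi> k) \<le> p k" if k: "k \<in> carrier (Lx V x)" for k
      proof -
        have "bdd_above ((\<lambda>b. \<nu> (k b)) ` B x)"
          using bdd_above_image_bounded_set[OF tvs _ sn[OF \<nu>(1)] ball Bb] k
          by (simp add: Lx_simps)
        then have "bdd_above (insert 0 ((\<lambda>b. \<nu> (k b)) ` B_set V \<E> B x))"
          using sub by (simp add: bdd_above_mono image_mono)
        then have "\<nu> (k b) \<le> p k"
          unfolding p_def sup0_def using B(2) by (intro cSup_upper) auto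
        then show ?thesis
          using le[OF app[OF k bc]] k by (simp add: \<phi>_def)
      qed
      moreover have "p \<zero>\<^bsub>Lx V x\<^esub> = 0"
      proof -
        have "\<nu> \<zero>\<^bsub>?M\<^esub> = 0"
          using sn[OF \<nu>(1)] smult_0[of "\<zero>\<^bsub>?M\<^esub>"] unfolding seminorm_on_def
          by (metis M.zero_closed mult_zero_left norm_zero)
        moreover have "B_set V \<E> B x \<subseteq> carrier ?M"
          using sub Bb by (auto simp: bounded_sets_def)
        ultimately have "(\<lambda>b. \<nu> (\<zero>\<^bsub>Lx V x\<^esub> b)) ` B_set V \<E> B x \<subseteq> {0}"
          by (auto simp: Lx_simps)
        \<comment> \<open>The \<open>0\<close> inserted by \<open>sup0\<close> turns the inclusion
          in \<open>{0}\<close> into an equality.\<close>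
        then have "insert 0 ((\<lambda>b. \<nu> (\<zero>\<^bsub>Lx V x\<^esub> b)) ` B_set V \<E> B x) = {0}" by blast
        then show ?thesis unfolding p_def sup0_def by (simp only: cSup_singleton)
      qed
      moreover have "p \<in> {\<lambda>f. sup0 ((\<lambda>b. \<nu> (f b)) ` B_set V \<E> B x) | \<nu> B. \<nu> \<in> seminorms V \<and> B \<in> \<Theta>}"
        unfolding p_def using \<nu>(1) B(1) by blast
      ultimately have "continuous_map (LS_top V \<E> \<Theta> x) euclidean \<phi>"
        unfolding LS_top_def by (intro L.continuous_map_linear_form[OF lin])
      then have "\<phi> \<in> top_dual (Lx V x) (LS_top V \<E> \<Theta> x)"
        using lin by (simp add: top_dual_iff \<phi>_def)
      from eq[OF this] have "\<psi> (f b) = \<psi> (g b)" using f g by (simp add: \<phi>_def)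
      moreover have "\<psi> ?d = \<psi> (f b) - \<psi> (g b)"
        using add hom app[OF f bc] app[OF g bc]
        by (intro linear_form_minus) (auto simp: linear_form_def)
      ultimately show False using \<psi>d \<nu>(2) by simp
    qed
  qed (use f g in \<open>auto simp: Lx_simps\<close>)
qed

section \<open>Weak integrals in the space of operator families\<close>

text \<open>The operator \<open>T\<^sub>x\<close> of the overview, the diagonal block of
  \<open>g\<close> at \<open>x\<close>. Restriction to the carrier makes it comparable with the
  extensional elements of \<open>endo_space\<close>.\<close>

definition component :: "'x set \<Rightarrow> ('x \<Rightarrow> 'e cvs) \<Rightarrow> 'x \<Rightarrow> (('x \<Rightarrow> 'e) \<Rightarrow> 'x \<Rightarrow> 'e) \<Rightarrow> 'e \<Rightarrow> 'e" where
  "component I E x g = (\<lambda>e\<in>carrier (E x). g (inj_factor I E x e) x)"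

text \<open>Abstracts from the bundle: of the operator topologies \<open>TL\<close> only the
  underlying set and the separation of points by the dual are kept. The latter is what
  \<open>Lx_separated\<close> supplies.\<close>

locale consistent_class =
  fixes I :: "'x set" and E :: "'x \<Rightarrow> 'e cvs" and TE :: "'x \<Rightarrow> 'e topology"
    and \<H> :: "('x \<Rightarrow> 'e) set" and \<TT> :: "('x \<Rightarrow> 'e) topology" and \<A> :: "('x \<Rightarrow> 'e \<Rightarrow> 'e) set"
    and TL :: "'x \<Rightarrow> ('e \<Rightarrow> 'e) topology"
  assumes consistent: "consistent_data I E TE \<H> \<TT> \<A>"
    and tvs: "\<And>x. x \<in> I \<Longrightarrow> topological_vs (E x) (TE x)"
    and topspace_TL: "\<And>x. x \<in> I \<Longrightarrow> topspace (TL x) = continuous_endos (E x) (TE x)"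
    and separated: "\<And>x f g. x \<in> I \<Longrightarrow> f \<in> carrier (endo_space (E x) (TE x)) \<Longrightarrow>
      g \<in> carrier (endo_space (E x) (TE x)) \<Longrightarrow>
      (\<And>\<phi>. \<phi> \<in> top_dual (endo_space (E x) (TE x)) (TL x) \<Longrightarrow> \<phi> f = \<phi> g) \<Longrightarrow> f = g"
begin

abbreviation "L \<equiv> \<lambda>x. endo_space (E x) (TE x)"
abbreviation "G \<equiv> G_space I E \<H> \<A>"
abbreviation "\<tau>G \<equiv> G_top I E TL \<H> \<A>"
definition "\<theta> = (\<lambda>u. restrict (theta_map I E u) \<H>)"

lemma L_simps:
  "carrier (L x) = continuous_endos (E x) (TE x)"
  "f \<oplus>\<^bsub>L x\<^esub> g = (\<lambda>e\<in>carrier (E x). f e \<oplus>\<^bsub>E x\<^esub> g e)"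
  "c \<odot>\<^bsub>L x\<^esub> f = (\<lambda>e\<in>carrier (E x). c \<odot>\<^bsub>E x\<^esub> f e)"
  "\<zero>\<^bsub>L x\<^esub> = (\<lambda>e\<in>carrier (E x). \<zero>\<^bsub>E x\<^esub>)"
  by (simp_all add: endo_space_def prod_space_def)

lemma vector_space_L: "x \<in> I \<Longrightarrow> complex_vs (L x)"
  using vector_space_on_endo_space[OF tvs] by (simp add: vector_space_on_iff)

lemma H_subset: "\<H> \<subseteq> (\<Pi>\<^sub>E x\<in>I. carrier (E x))"
  using linear_subspace_subset[of \<H> "prod_space I E"] consistent
  by (simp add: consistent_data_def prod_space_def)

lemma A_subspace: "linear_subspace \<A> (prod_space I L)"
  using consistent by (simp add: consistent_data_def)

lemma A_in: "u \<in> \<A> \<Longrightarrow> x \<in> I \<Longrightarrow> u x \<in> continuous_endos (E x) (TE x)"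
  using linear_subspace_subset[OF A_subspace] by (auto simp: prod_space_def L_simps)

lemma theta_apply: "v \<in> \<H> \<Longrightarrow> \<theta> u v = (\<lambda>x\<in>I. u x (v x))"
  using H_subset by (auto simp: \<theta>_def theta_map_def prod_space_def)

lemma theta_undefined: "v \<notin> \<H> \<Longrightarrow> \<theta> u v = undefined"
  by (simp add: \<theta>_def)

lemma inj_factor_in: "x \<in> I \<Longrightarrow> e \<in> carrier (E x) \<Longrightarrow> inj_factor I E x e \<in> \<H>"
  using consistent by (auto simp: consistent_data_def)

text \<open>The vector \<open>inj_factor I E x e\<close> has \<open>e\<close> at \<open>x\<close>,
  so \<open>\<theta> u\<close> sends it to a vector with \<open>u x e\<close> there. Thus the blocks
  recover \<open>u\<close>, and questions about \<open>G\<close> reduce to families in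
  \<open>\<A>\<close>.\<close>

lemma component_theta:
  assumes "u \<in> \<A>" "x \<in> I"
  shows "component I E x (\<theta> u) = u x"
proof -
  have "component I E x (\<theta> u) \<in> extensional (carrier (E x))"
    by (simp add: component_def)
  moreover have "u x \<in> extensional (carrier (E x))"
    using A_in[OF assms] by (auto simp: continuous_endos_def endomorphisms_def PiE_def)
  ultimately show ?thesis
  proof (rule extensionalityI)
    fix e assume e: "e \<in> carrier (E x)"
    then show "component I E x (\<theta> u) e = u x e"
      using theta_apply[OF inj_factor_in[OF assms(2) e]] assms(2)
      by (simp add: component_def inj_factor_def)
  qed
qed

text \<open>On \<open>\<H>\<close> both sides agree coordinatewise, and off \<open>\<H>\<close> both
  are \<open>undefined\<close>. With \<open>theta_smult\<close> this makes \<open>\<theta>\<close>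
  linear on \<open>\<A>\<close>.\<close>

lemma theta_add:
  assumes "u \<in> \<A>" "w \<in> \<A>"
  shows "\<theta> u \<oplus>\<^bsub>G\<^esub> \<theta> w = \<theta> (u \<oplus>\<^bsub>prod_space I L\<^esub> w)"
proof
  fix v
  show "(\<theta> u \<oplus>\<^bsub>G\<^esub> \<theta> w) v = \<theta> (u \<oplus>\<^bsub>prod_space I L\<^esub> w) v"
  proof (cases "v \<in> \<H>")
    case True
    then have "v x \<in> carrier (E x)" if "x \<in> I" for x using H_subset that by auto
    with True show ?thesis
      by (auto simp: G_space_def H_space_def prod_space_def L_simps theta_apply
          intro!: restrict_ext)
  qed (simp add: G_space_def prod_space_def theta_undefined)
qed

lemma theta_smult:
  assumes "u \<in> \<A>"
  shows "c \<odot>\<^bsub>G\<^esub> \<theta> u = \<theta> (c \<odot>\<^bsub>prod_space I L\<^esub> u)"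
proof
  fix v
  show "(c \<odot>\<^bsub>G\<^esub> \<theta> u) v = \<theta> (c \<odot>\<^bsub>prod_space I L\<^esub> u) v"
  proof (cases "v \<in> \<H>")
    case True
    then have "v x \<in> carrier (E x)" if "x \<in> I" for x using H_subset that by auto
    with True show ?thesis
      by (auto simp: G_space_def H_space_def prod_space_def L_simps theta_apply
          intro!: restrict_ext)
  qed (simp add: G_space_def prod_space_def theta_undefined)
qed

lemma carrier_G: "carrier G = \<theta> ` \<A>"
  by (simp add: G_space_def \<theta>_def)

text \<open>The carrier is the image of the subspace \<open>\<A>\<close> under the linear map
  \<open>\<theta>\<close>, inside the functions from \<open>\<H>\<close> to \<open>\<H>\<close>;
  consistency keeps the values in \<open>\<H>\<close>.\<close>

lemma vector_space_G: "complex_vs G"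
proof -
  have H: "vector_space_on (H_space I E \<H>)"
    using consistent
    by (simp add: consistent_data_def Hlcs_def locally_convex_def topological_vs_def)
  interpret P: complex_vs "prod_space \<H> (\<lambda>_. H_space I E \<H>)"
    using vector_space_on_prod_space[of \<H> "\<lambda>_. H_space I E \<H>"] H
    by (simp add: vector_space_on_iff)
  have "linear_subspace (\<theta> ` \<A>) (prod_space \<H> (\<lambda>_. H_space I E \<H>))"
  proof (rule P.linear_subspaceI)
    show "\<theta> ` \<A> \<subseteq> carrier (prod_space \<H> (\<lambda>_. H_space I E \<H>))"
    proof
      fix g assume "g \<in> \<theta> ` \<A>"
      then have "g \<in> continuous_endos (H_space I E \<H>) \<TT>"
        using consistent by (auto simp: consistent_data_def \<theta>_def)
      then show "g \<in> carrier (prod_space \<H> (\<lambda>_. H_space I E \<H>))"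
        by (simp add: continuous_endos_def endomorphisms_def prod_space_def H_space_def)
    qed
    show "\<theta> ` \<A> \<noteq> {}" using linear_subspace_zero[OF A_subspace] by blast
  next
    fix a b assume "a \<in> \<theta> ` \<A>" "b \<in> \<theta> ` \<A>"
    then obtain u w where uw: "u \<in> \<A>" "w \<in> \<A>" "a = \<theta> u" "b = \<theta> w" by blast
    then have "a \<oplus>\<^bsub>G\<^esub> b \<in> \<theta> ` \<A>"
      using theta_add[OF uw(1,2)] linear_subspace_add[OF A_subspace uw(1,2)] by blast
    then show "a \<oplus>\<^bsub>prod_space \<H> (\<lambda>_. H_space I E \<H>)\<^esub> b \<in> \<theta> ` \<A>"
      by (simp add: G_space_def)
  next
    fix c :: complex and a assume "a \<in> \<theta> ` \<A>"
    then obtain u where u: "u \<in> \<A>" "a = \<theta> u" by blast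
    then have "c \<odot>\<^bsub>G\<^esub> a \<in> \<theta> ` \<A>"
      using theta_smult[OF u(1)] linear_subspace_smult[OF A_subspace u(1)] by blast
    then show "c \<odot>\<^bsub>prod_space \<H> (\<lambda>_. H_space I E \<H>)\<^esub> a \<in> \<theta> ` \<A>"
      by (simp add: G_space_def)
  qed
  from vector_space_on_subspace[OF P.module_axioms this] show ?thesis
    by (simp add: G_space_def \<theta>_def vector_space_on_iff)
qed

text \<open>Consistency puts the family that is \<open>f\<close> at \<open>x\<close> and zero
  elsewhere into \<open>\<A>\<close>; writing \<open>h_map\<close> as \<open>\<theta>\<close> of it
  lets \<open>component_theta\<close> compute its blocks.\<close>

lemma h_map_eq:
  assumes "x \<in> I" "f \<in> continuous_endos (E x) (TE x)"
  shows "inj_factor I L x f \<in> \<A>" "h_map I E \<H> x f = \<theta> (inj_factor I L x f)"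
proof -
  show "inj_factor I L x f \<in> \<A>" using consistent assms unfolding consistent_data_def by blast
  show "h_map I E \<H> x f = \<theta> (inj_factor I L x f)"
  proof
    fix v
    show "h_map I E \<H> x f v = \<theta> (inj_factor I L x f) v"
    proof (cases "v \<in> \<H>")
      case True
      then have "v y \<in> carrier (E y)" if "y \<in> I" for y using H_subset that by auto
      with True show ?thesis
        by (auto simp: h_map_def inj_factor_def L_simps theta_apply intro!: restrict_ext)
    qed (simp add: h_map_def theta_undefined)
  qed
qed

section \<open>Continuous linear forms and weak integrals on \<open>G\<close>\<close>

lemma component_in: "g \<in> carrier G \<Longrightarrow> x \<in> I \<Longrightarrow> component I E x g \<in> carrier (L x)"
  using A_in by (auto simp: carrier_G component_theta L_simps(1))

text \<open>By \<open>top_dual_finest_lc_topology\<close> continuity is tested on the compositions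
  with \<open>h_map\<close>, which are \<open>\<phi>\<close> for the index \<open>x\<close> and zero
  for every other index.\<close>

lemma top_dual_component:
  assumes x: "x \<in> I" and \<phi>: "\<phi> \<in> top_dual (L x) (TL x)"
  shows "(\<lambda>g\<in>carrier G. \<phi> (component I E x g)) \<in> top_dual G \<tau>G"
proof -
  interpret G: complex_vs G by (rule vector_space_G)
  interpret L: complex_vs "L x" using x by (rule vector_space_L)
  have lin: "linear_form (L x) \<phi>" and cont: "continuous_map (TL x) euclidean \<phi>"
    using \<phi> by (auto simp: top_dual_iff)
  let ?\<Phi> = "\<lambda>g\<in>carrier G. \<phi> (component I E x g)"
  show ?thesis
    unfolding G_top_def
  proof (rule G.top_dual_finest_lc_topology)
    show hc: "h_map I E \<H> i \<in> topspace (TL i) \<rightarrow> carrier G" if "i \<in> I" for i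
      using h_map_eq[OF that] topspace_TL[OF that] by (auto simp: carrier_G)
    show "linear_form G ?\<Phi>"
      unfolding linear_form_def
    proof (intro conjI ballI allI)
      fix a b assume ab: "a \<in> carrier G" "b \<in> carrier G"
      then obtain u w where uw: "u \<in> \<A>" "w \<in> \<A>" "a = \<theta> u" "b = \<theta> w"
        unfolding carrier_G by blast
      have "component I E x (a \<oplus>\<^bsub>G\<^esub> b) = component I E x a \<oplus>\<^bsub>L x\<^esub> component I E x b"
        unfolding uw(3,4) theta_add[OF uw(1,2)]
          component_theta[OF linear_subspace_add[OF A_subspace uw(1,2)] x]
          component_theta[OF uw(1) x] component_theta[OF uw(2) x]
        using x by (simp add: prod_space_def)
      then show "?\<Phi> (a \<oplus>\<^bsub>G\<^esub> b) = ?\<Phi> a + ?\<Phi> b"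
        using lin ab component_in[OF _ x] by (simp add: linear_form_def G.M.a_closed)
    next
      fix c a assume a: "a \<in> carrier G"
      then obtain u where u: "u \<in> \<A>" "a = \<theta> u" unfolding carrier_G by blast
      have "component I E x (c \<odot>\<^bsub>G\<^esub> a) = c \<odot>\<^bsub>L x\<^esub> component I E x a"
        unfolding u(2) theta_smult[OF u(1)]
          component_theta[OF linear_subspace_smult[OF A_subspace u(1)] x]
          component_theta[OF u(1) x]
        using x by (simp add: prod_space_def)
      then show "?\<Phi> (c \<odot>\<^bsub>G\<^esub> a) = c * ?\<Phi> a"
        using lin a component_in[OF a x] by (simp add: linear_form_def G.smult_in)
    qed
    fix i assume i: "i \<in> I"
    have ev: "?\<Phi> (h_map I E \<H> i f) = (if i = x then \<phi> f else 0)" if f: "f \<in> topspace (TL i)" for f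
    proof -
      have f': "f \<in> continuous_endos (E i) (TE i)" using f topspace_TL[OF i] by simp
      have "component I E x (h_map I E \<H> i f) = (if i = x then f else \<zero>\<^bsub>L x\<^esub>)"
        using h_map_eq[OF i f'] component_theta[OF h_map_eq(1)[OF i f'] x] x
        by (auto simp: inj_factor_def)
      then show ?thesis
        using hc[OF i] f L.linear_form_zero[OF lin] by auto
    qed
    show "continuous_map (TL i) euclidean (\<lambda>f. ?\<Phi> (h_map I E \<H> i f))"
    proof (cases "i = x")
      case True
      show ?thesis
        by (rule continuous_map_eq[OF cont[folded True]]) (use ev True in simp)
    next
      case False
      show ?thesis
        by (rule continuous_map_eq[of _ _ "\<lambda>_. 0"]) (use ev False in simp_all)
    qed
  qed simp
qed

text \<open>Through \<open>top_dual_component\<close> the forms on \<open>G\<close> include all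
  tests of the blocks, so \<open>separated\<close> makes the underlying families equal at each
  point.\<close>

lemma G_separated:
  assumes "g \<in> carrier G" "g' \<in> carrier G"
    and eq: "\<And>\<phi>. \<phi> \<in> top_dual G \<tau>G \<Longrightarrow> \<phi> g = \<phi> g'"
  shows "g = g'"
proof -
  obtain u w where uw: "u \<in> \<A>" "w \<in> \<A>" "g = \<theta> u" "g' = \<theta> w"
    using assms unfolding carrier_G by blast
  have "u x = w x" if x: "x \<in> I" for x
  proof (rule separated[OF x])
    fix \<phi> assume "\<phi> \<in> top_dual (L x) (TL x)"
    from eq[OF top_dual_component[OF x this]] show "\<phi> (u x) = \<phi> (w x)"
      using assms(1,2) component_theta[OF uw(1) x] component_theta[OF uw(2) x] uw(3,4) by simp
  qed (use A_in uw x in \<open>auto simp: L_simps\<close>)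
  moreover have "u \<in> extensional I" "w \<in> extensional I"
    using linear_subspace_subset[OF A_subspace] uw by (auto simp: prod_space_def PiE_def)
  ultimately have "u = w" by (intro extensionalityI[of u I w])
  then show ?thesis using uw by simp
qed

text \<open>Membership in \<open>L1\<close> gives existence and \<open>G_separated\<close> gives
  uniqueness, so the definite description denotes a weak integral.\<close>

lemma is_weak_integral_weak_integral:
  assumes "F \<in> L1 G \<tau>G \<mu>"
  shows "is_weak_integral G \<tau>G \<mu> F (weak_integral G \<tau>G \<mu> F)"
proof -
  obtain z where z: "is_weak_integral G \<tau>G \<mu> F z" using assms by (auto simp: L1_def)
  then have "weak_integral G \<tau>G \<mu> F = z"
    by (rule weak_integral_eqI) (use G_separated z in \<open>auto simp: is_weak_integral_def\<close>)
  with z show ?thesis by simp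
qed

text \<open>A continuous form composed with \<open>component\<close> is a continuous form on
  \<open>G\<close>, so the defining equation in \<open>G\<close> yields the one for \<open>f\<close>
  in the stalk. Agreement is asked on the space of \<open>\<mu>\<close> because \<open>Psi\<close>
  is cut off outside the half line.\<close>

lemma weak_integral_component:
  assumes F: "F \<in> L1 G \<tau>G \<mu>" and x: "x \<in> I"
    and f: "\<And>s. s \<in> space \<mu> \<Longrightarrow> f s = component I E x (F s)"
  shows "weak_integral (L x) (TL x) \<mu> f = component I E x (weak_integral G \<tau>G \<mu> F)"
proof -
  let ?z = "weak_integral G \<tau>G \<mu> F"
  have z: "is_weak_integral G \<tau>G \<mu> F ?z" by (rule is_weak_integral_weak_integral[OF F])
  then have zG: "?z \<in> carrier G" by (simp add: is_weak_integral_def)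
  have "is_weak_integral (L x) (TL x) \<mu> f (component I E x ?z)"
    unfolding is_weak_integral_def
  proof (intro conjI ballI)
    show "component I E x ?z \<in> carrier (L x)" using component_in[OF zG x] .
    fix \<phi> assume "\<phi> \<in> top_dual (L x) (TL x)"
    from top_dual_component[OF x this] z
    have "(\<lambda>g\<in>carrier G. \<phi> (component I E x g)) ?z =
        (LINT s|\<mu>. (\<lambda>g\<in>carrier G. \<phi> (component I E x g)) (F s))"
      by (simp add: is_weak_integral_def del: restrict_apply)
    also have "\<dots> = (LINT s|\<mu>. \<phi> (f s))"
      by (rule Bochner_Integration.integral_cong) (use F f in \<open>auto simp: L1_def\<close>)
    finally show "\<phi> (component I E x ?z) = (LINT s|\<mu>. \<phi> (f s))" using zG by simp
  qed
  then show ?thesis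
    by (rule weak_integral_eqI) (use separated[OF x] component_in[OF zG x] in auto)
qed

text \<open>An operator in \<open>G\<close> acts coordinatewise by its blocks; this reassembles
  integrals taken stalk by stalk into one vector of the product.\<close>

lemma component_apply:
  assumes "g \<in> carrier G" "v \<in> \<H>"
  shows "g v = (\<lambda>x\<in>I. component I E x g (v x))"
  using assms component_theta theta_apply[OF assms(2)]
  by (auto simp: carrier_G intro!: restrict_ext)

end

section \<open>The property \<open>LD\<close> in terms of integrals in \<open>G\<close>\<close>

lemma space_mu: "space (mu l) = {0..}"
  by (simp add: mu_def)

theorem corollary2p3p30:
  fixes V :: "('e, 'x) omega_bundle"
    and \<X> :: "'x set"
    and \<E> :: "('x \<Rightarrow> 'e) set"
    and \<Theta> :: "('x \<Rightarrow> 'e set) set"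
    and \<MM> :: "'x \<Rightarrow> (real \<Rightarrow> 'e \<Rightarrow> 'e) set"
    and \<gamma> :: "('x \<times> (real \<Rightarrow> 'e \<Rightarrow> 'e)) topology"
    and \<H> :: "('x \<Rightarrow> 'e) set"
    and \<TT> :: "('x \<Rightarrow> 'e) topology"
    and \<A> :: "('x \<Rightarrow> 'e \<Rightarrow> 'e) set"
    and G :: "(('x \<Rightarrow> 'e) \<Rightarrow> ('x \<Rightarrow> 'e)) cvs"
    and \<tau>G :: "(('x \<Rightarrow> 'e) \<Rightarrow> ('x \<Rightarrow> 'e)) topology"
    and \<O> :: "('x \<Rightarrow> 'x \<times> (real \<Rightarrow> 'e \<Rightarrow> 'e)) set"
    and \<D> :: "('x \<Rightarrow> 'e) set"
  defines "\<X> \<equiv> topspace (base_top V)"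
    and "G \<equiv> G_space \<X> (stalk V) \<H> \<A>"
    and "\<tau>G \<equiv> G_top \<X> (stalk V) (LS_top V \<E> \<Theta>) \<H> \<A>"
  assumes "Theta_E_structure V \<E> \<Theta> (top_of_set {0..}) \<MM> \<gamma>"
    and "\<forall>x\<in>\<X>. \<MM> x \<subseteq> (\<Inter>l\<in>{0<..}. L1 (Lx V x) (LS_top V \<E> \<Theta> x) (mu l))"
    and "consistent_data \<X> (stalk V) (stalk_top V) \<H> \<TT> \<A>"
    and "Gamma_sec V \<inter> \<H> \<inter> (\<Pi>\<^sub>E x\<in>\<X>. \<Union>B\<in>\<Theta>. B_set V \<E> B x) \<noteq> {}"
    and "\<O> \<subseteq> Gamma_sec (op_bundle V \<E> \<Theta> (top_of_set {0..}) \<gamma>)"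
    and "\<D> \<subseteq> Gamma_sec V \<inter> \<H> \<inter> (\<Pi>\<^sub>E x\<in>\<X>. \<Union>B\<in>\<Theta>. B_set V \<E> B x)"
  shows "(\<forall>\<F>. \<F> \<subseteq> (\<Inter>l\<in>{0<..}. L1 G \<tau>G (mu l)) \<and>
              (\<lambda>F. as_section \<X> (Psi \<X> (stalk V) {0..} F)) ` \<F> = \<O> \<longrightarrow>
            (LD V \<E> \<Theta> \<O> \<D> \<longleftrightarrow>
             (\<forall>l>0. \<forall>F\<in>\<F>. \<forall>v\<in>\<D>. weak_integral G \<tau>G (mu l) F v \<in> Gamma_sec V))) \<and>
         ((\<exists>\<F>. \<F> \<subseteq> (\<Inter>l\<in>{0<..}. L1 G \<tau>G (mu l)) \<and>
              (\<lambda>F. as_section \<X> (Psi \<X> (stalk V) {0..} F)) ` \<F> = \<O>) \<and>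
          (\<forall>g\<in>carrier G. \<forall>v\<in>\<D>. g v \<in> Gamma_sec V) \<longrightarrow>
          LD V \<E> \<Theta> \<O> \<D>)"
proof -
  note S = assms(4) and cd = assms(6) and \<D> = assms(9)
  have V: "bundle_of_Omega_spaces V" using S by (simp add: Theta_E_structure_def)
  \<comment> \<open>Totality of the sets \<open>B_set\<close> and the Hausdorff stalks enter here,
    through \<open>Lx_separated\<close>.\<close>
  interpret consistent_class \<X> "stalk V" "stalk_top V" \<H> \<TT> \<A> "LS_top V \<E> \<Theta>"
  proof
    show "consistent_data \<X> (stalk V) (stalk_top V) \<H> \<TT> \<A>" by (rule cd)
    fix x assume "x \<in> \<X>"
    then have x: "x \<in> topspace (base_top V)" by (simp add: \<X>_def)
    show "topological_vs (stalk V x) (stalk_top V x)" by (rule topological_vs_stalk[OF V x])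
    show "topspace (LS_top V \<E> \<Theta> x) = continuous_endos (stalk V x) (stalk_top V x)"
      by (simp add: LS_top_def topspace_seminorm_topology Lx_simps)
    show "f = g" if "f \<in> carrier (endo_space (stalk V x) (stalk_top V x))"
      "g \<in> carrier (endo_space (stalk V x) (stalk_top V x))"
      "\<And>\<phi>. \<phi> \<in> top_dual (endo_space (stalk V x) (stalk_top V x)) (LS_top V \<E> \<Theta> x) \<Longrightarrow> \<phi> f = \<phi> g"
      for f g
      using Lx_separated[OF S x] that by (simp add: Lx_def)
  qed
  \<comment> \<open>An equality of functions on the whole type, as both sides are
    \<open>undefined\<close> outside \<open>\<X>\<close>; so membership in \<open>Gamma_sec\<close>
    transfers by rewriting.\<close>
  have key: "(\<lambda>x\<in>topspace (base_top V). weak_integral (Lx V x) (LS_top V \<E> \<Theta> x) (mu l)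
      (snd (as_section \<X> (Psi \<X> (stalk V) {0..} F) x)) (v x)) = weak_integral G \<tau>G (mu l) F v"
    and zG: "weak_integral G \<tau>G (mu l) F \<in> carrier G"
    if F: "F \<in> L1 G \<tau>G (mu l)" and v: "v \<in> \<D>" for l F v
  proof -
    note F' = F[unfolded G_def \<tau>G_def]
    show z: "weak_integral G \<tau>G (mu l) F \<in> carrier G"
      using is_weak_integral_weak_integral[OF F'] by (simp add: is_weak_integral_def G_def \<tau>G_def)
    have "weak_integral (Lx V x) (LS_top V \<E> \<Theta> x) (mu l)
        (snd (as_section \<X> (Psi \<X> (stalk V) {0..} F) x)) =
        component \<X> (stalk V) x (weak_integral G \<tau>G (mu l) F)" if "x \<in> \<X>" for x
      unfolding Lx_def G_def \<tau>G_def
      by (rule weak_integral_component[OF F' that])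
        (use that in \<open>simp add: space_mu as_section_def Psi_def component_def\<close>)
    moreover have "v \<in> \<H>" using v \<D> by blast
    ultimately show "(\<lambda>x\<in>topspace (base_top V). weak_integral (Lx V x) (LS_top V \<E> \<Theta> x) (mu l)
      (snd (as_section \<X> (Psi \<X> (stalk V) {0..} F) x)) (v x)) = weak_integral G \<tau>G (mu l) F v"
      using component_apply[OF z[unfolded G_def], folded G_def]
      by (simp add: \<X>_def[symmetric] cong: restrict_cong)
  qed
  have iff: "LD V \<E> \<Theta> \<O> \<D> \<longleftrightarrow>
      (\<forall>l>0. \<forall>F\<in>\<F>. \<forall>v\<in>\<D>. weak_integral G \<tau>G (mu l) F v \<in> Gamma_sec V)"
    if "\<F> \<subseteq> (\<Inter>l\<in>{0<..}. L1 G \<tau>G (mu l))"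
      "(\<lambda>F. as_section \<X> (Psi \<X> (stalk V) {0..} F)) ` \<F> = \<O>" for \<F>
  proof -
    have "F \<in> L1 G \<tau>G (mu l)" if "F \<in> \<F>" "l > 0" for F l
      using that \<open>\<F> \<subseteq> _\<close> by auto
    \<comment> \<open>Since \<open>\<O>\<close> is the image of \<open>\<F>\<close>, quantification
      over \<open>\<O>\<close> becomes quantification over \<open>\<F>\<close>, and
      \<open>key\<close> rewrites each section.\<close>
    then show ?thesis
      unfolding LD_def \<open>_ = \<O>\<close>[symmetric] ball_simps using key by simp
  qed
  show ?thesis
  proof (intro conjI allI impI, goal_cases)
    case (1 \<F>)
    then show ?case using iff by blast
  next
    case 2
    then obtain \<F> where \<F>: "\<F> \<subseteq> (\<Inter>l\<in>{0<..}. L1 G \<tau>G (mu l))"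
      "(\<lambda>F. as_section \<X> (Psi \<X> (stalk V) {0..} F)) ` \<F> = \<O>" by blast
    have "weak_integral G \<tau>G (mu l) F v \<in> Gamma_sec V"
      if "l > 0" "F \<in> \<F>" "v \<in> \<D>" for l F v
    proof -
      have "F \<in> L1 G \<tau>G (mu l)" using that \<F>(1) by auto
      \<comment> \<open>The integral is itself an element of \<open>G\<close>, so the hypothesis on
        \<open>carrier G\<close> applies to it.\<close>
      from zG[OF this that(3)] show ?thesis using 2 that(3) by blast
    qed
    then show ?case using iff[OF \<F>] by blast
  qed
qed

end
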